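(* Let $m_1,m_2,\ldots$ be strictly positive integers such that $M(z)=\sum_{i\ge1}m_iz^i/i!$ has strictly positive radius of convergence. Fix a sequence of integers $k(1),k(2),\dots\ge1$ with $1\le k(n)\le n$, and write $k=k(n)$, $r=n-k$. Given $n$, pick an assembly uniformly from the $p(n,k)$ $M$-assemblies of size $n$ having exactly $k$ components; let $L_1$ be the size of its largest component and $D_i(n,k)$ the number of its components of size $i$. Assume that for some $\varepsilon>0$, $r=o(n^{1-\varepsilon})$. Then for $\ell=1,2,\ldots$, as $n\to\infty$: (1) If $r=o(n^{\ell/(1+\ell)})$, then $\mathbb P(L_1\le\ell+1)\to1$. (2) If $n^{\ell/(1+\ell)}=o(r)$, then $\mathbb P(L_1>\ell+1)\to1$. (3) If $\liminf \log_n r>\ell/(\ell+1)$, then, with $x=x(n)$ defined for all sufficiently large $n$ as the smallest positive solution of $$\frac{m_2x^2/2}{M(x)}=\frac rk ,$$ for each $i$ with $1\le i\le\ell+2$, $$1=\mathbb P\Bigl(D_i(n,k)\sim k\,\frac{m_i\,x^{i-1}}{m_1\,i!}\Bigr).$$ (4) If for fixed $t>0$ we have $r\sim t\,n^{\ell/(1+\ell)}$, then with $$\lambda\equiv\lambda(t,\ell,M):=\frac{2^{\ell+1}\,m_1^{\ell}\,m_{\ell+2}}{(\ell+2)!\,m_2^{\ell+1}}\;t^{\ell+1},$$ $$\mathbb P(L_1=\ell+1)\to e^{-\lambda}\qquad\text{and}\qquad\mathbb P(L_1=\ell+2)\to1-e^{-\lambda}.$$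
   Context: Given nonnegative integers $m_1,m_2,\ldots$ with exponential generating function $M(z)=\sum_{i\ge1}m_iz^i/i!$, an $M$-assembly of size $n$ is obtained by choosing a set partition of $\{1,\dots,n\}$ into nonempty blocks and, for each block of size $i$, choosing one of $m_i$ possible decorations. The decorated blocks are the components; the size of a component is the size of its block. $p(n,k)$ is the number of $M$-assemblies of size $n$ with exactly $k$ components; equivalently $\sum_{n,k\ge0}p(n,k)z^n\theta^k/n!=e^{\theta M(z)}$. $a_n\sim b_n$ means $a_n/b_n\to1$ as $n\to\infty$. *)

theory Defs
  imports "HOL-Probability.Probability" "HOL-Library.Landau_Symbols"
begin

text \<open>An assembly is a pair of a set partition of \<open>{1..n}\<close> and a function choosing for each block
  \<open>B\<close> one of the \<open>m (card B)\<close> decorations \<open>0, \<dots>, m (card B) - 1\<close>. The decoration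
  function is extensional (\<open>undefined\<close> off the blocks), so that distinct pairs are distinct
  assemblies. The value \<open>m 0\<close> is never used.\<close>

type_synonym assembly = "nat set set \<times> (nat set \<Rightarrow> nat)"

definition assemblies :: "(nat \<Rightarrow> nat) \<Rightarrow> nat \<Rightarrow> assembly set" where
  "assemblies m n = (SIGMA P:{P. partition_on {1..n} P}. Pi\<^sub>E P (\<lambda>B. {..<m (card B)}))"

definition num_components :: "assembly \<Rightarrow> nat" where
  "num_components a = card (fst a)"

definition assemblies_k :: "(nat \<Rightarrow> nat) \<Rightarrow> nat \<Rightarrow> nat \<Rightarrow> assembly set" where
  "assemblies_k m n k = {a \<in> assemblies m n. num_components a = k}"

definition largest_component :: "assembly \<Rightarrow> nat" where
  "largest_component a = Max (card ` fst a)"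

definition components_of_size :: "nat \<Rightarrow> assembly \<Rightarrow> nat" where
  "components_of_size i a = card {B \<in> fst a. card B = i}"

text \<open>\<open>pmf_of_set\<close> is the uniform distribution for finite nonempty sets; \<open>assemblies_k m n k\<close> is
  such a set whenever \<open>1 \<le> k \<le> n\<close> and all \<open>m i\<close> with \<open>i \<ge> 1\<close> are positive.\<close>

definition random_assembly :: "(nat \<Rightarrow> nat) \<Rightarrow> nat \<Rightarrow> nat \<Rightarrow> assembly pmf" where
  "random_assembly m n k = pmf_of_set (assemblies_k m n k)"

text \<open>An event about the whole sequence of random assemblies needs all of them to live on one
  probability space. Only the marginal laws are prescribed; the joint law is arbitrary.\<close>

definition coupled_assemblies ::
    "(nat \<Rightarrow> nat) \<Rightarrow> (nat \<Rightarrow> nat) \<Rightarrow> 'w measure \<Rightarrow> (nat \<Rightarrow> 'w \<Rightarrow> assembly) \<Rightarrow> bool" where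
  "coupled_assemblies m k \<Omega> A \<longleftrightarrow>
     prob_space \<Omega> \<and>
     (\<forall>n\<ge>1. A n \<in> measurable \<Omega> (count_space UNIV) \<and>
            distr \<Omega> (count_space UNIV) (A n) = measure_pmf (random_assembly m n (k n)))"

definition assembly_egf :: "(nat \<Rightarrow> nat) \<Rightarrow> real fps" where
  "assembly_egf m = Abs_fps (\<lambda>i. if i = 0 then 0 else real (m i) / fact i)"

definition pos_solution :: "(nat \<Rightarrow> nat) \<Rightarrow> real \<Rightarrow> real \<Rightarrow> bool" where
  "pos_solution m c x \<longleftrightarrow>
     x > 0 \<and> summable (\<lambda>i. fps_nth (assembly_egf m) i * x ^ i) \<and>
     (real (m 2) * x ^ 2 / 2) / eval_fps (assembly_egf m) x = c"

definition smallest_pos_solution :: "(nat \<Rightarrow> nat) \<Rightarrow> real \<Rightarrow> real \<Rightarrow> bool" where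
  "smallest_pos_solution m c x \<longleftrightarrow>
     pos_solution m c x \<and> (\<forall>y. pos_solution m c y \<longrightarrow> x \<le> y)"

definition limit_lambda :: "real \<Rightarrow> nat \<Rightarrow> (nat \<Rightarrow> nat) \<Rightarrow> real" where
  "limit_lambda t l m =
     2 ^ (l + 1) * real (m 1) ^ l * real (m (l + 2)) / (fact (l + 2) * real (m 2) ^ (l + 1))
       * t ^ (l + 1)"

end

theory Submission
  imports Defs
begin

text \<open>
  Write \<open>a\<^sub>s = m\<^sub>s\<^sub>+\<^sub>1 / (s + 1)!\<close> and \<open>A(z) = \<Sum> a\<^sub>s z\<^sup>s = M(z) / z\<close>. For a set \<open>T\<close> of indices let \<open>N\<^sub>T\<close> be the number of
  components whose size minus one lies in \<open>T\<close>, and let \<open>A\<^sub>v\<close> arise from \<open>A\<close> by multiplying the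
  coefficients with index in \<open>T\<close> by \<open>v\<close>. Summing \<open>v^N\<^sub>T\<close> over the assemblies gives \<open>n!/k! F(v)\<close> with
  \<open>F(v) = [z\<^sup>r] A\<^sub>v\<^sup>k\<close>, so \<open>E v^N\<^sub>T = F(v) / F(1)\<close>.

  Comparing the two identities \<open>c(k,r) = \<Sum> a\<^sub>s c(k-1,r-s)\<close> and \<open>r c(k,r) = k \<Sum> s a\<^sub>s c(k-1,r-s)\<close> for
  \<open>c(k,r) = [z\<^sup>r] A\<^sup>k\<close> yields sharp two-sided bounds for \<open>c(k-1,r-s) / c(k,r)\<close> as long as \<open>r/k\<close> is small.
  They only involve \<open>a\<^sub>0\<close>, \<open>a\<^sub>1\<close> and an error term, hence hold uniformly for all \<open>A\<^sub>v\<close>, and they show that the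
  logarithmic derivative of \<open>F\<close> is asymptotic to \<open>\<mu> = k a\<^sub>s/a\<^sub>0 (a\<^sub>0 r / (a\<^sub>1 k))\<^sup>s\<close> with \<open>s = min T\<close>. Integrating, \<open>N\<^sub>T\<close> has
  the generating function \<open>exp((v - 1) \<mu> (1 + o(1)))\<close> of a Poisson variable. At \<open>v = 0\<close> with \<open>T = {l+1..}\<close> this
  is the probability that \<open>L\<^sub>1 \<le> l + 1\<close>; for \<open>v\<close> near 1 it gives Chernoff bounds, which are summable
  when \<open>\<mu>\<close> grows like a power of \<open>n\<close>, and the Borel--Cantelli lemma applies.
\<close>

section \<open>Coefficients of powers of a power series\<close>

unbundle no vec_syntax
unbundle fps_syntax

context
  fixes A :: "real fps"
  assumes nonneg: "\<And>i. A $ i \<ge> 0" and A0: "A $ 0 > 0" and A1: "A $ 1 > 0"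
begin

lemma fps_power_nth_nonneg: "(A ^ k) $ r \<ge> 0"
proof (induction k arbitrary: r)
  case (Suc k)
  then show ?case by (auto simp: fps_mult_nth nonneg intro!: sum_nonneg)
qed auto

text \<open>Compares coefficients in \<open>z (A^(k+1))' = (k+1) (z A') A^k\<close>. In other words,
  among sequences of \<open>k + 1\<close> indices with sum \<open>r\<close>, weighted by the product
  of their coefficients, every entry has the same mean \<open>r / (k + 1)\<close>.\<close>

lemma fps_power_nth_first_moment:
  "real r * (A ^ Suc k) $ r = real (Suc k) * (\<Sum>s=0..r. real s * A $ s * (A ^ k) $ (r - s))"
proof -
  have "real r * (A ^ Suc k) $ r = (fps_X * fps_deriv (A ^ Suc k)) $ r"
    by (cases r) (auto simp del: power_Suc)
  also have "fps_X * fps_deriv (A ^ Suc k)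
    = fps_const (real (Suc k)) * ((fps_X * fps_deriv A) * A ^ k)"
    by (subst fps_deriv_power) (simp only: diff_Suc_1 mult_ac)
  also have "\<dots> $ r = real (Suc k) * (\<Sum>s=0..r. (fps_X * fps_deriv A) $ s * (A ^ k) $ (r - s))"
    by (simp only: fps_mult_left_const_nth) (simp add: fps_mult_nth)
  also have "(\<lambda>s. (fps_X * fps_deriv A) $ s) = (\<lambda>s. real s * A $ s)"
  proof
    fix s show "(fps_X * fps_deriv A) $ s = real s * A $ s" by (cases s) auto
  qed
  finally show ?thesis .
qed

lemma fps_power_nth_Suc_ge: "A $ 0 * (A ^ k) $ r \<le> (A ^ Suc k) $ r"
proof -
  have "(\<Sum>s\<in>{0}. A $ s * (A ^ k) $ (r - s)) \<le> (\<Sum>s=0..r. A $ s * (A ^ k) $ (r - s))"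
    by (rule sum_mono2) (auto simp: nonneg fps_power_nth_nonneg)
  then show ?thesis by (simp add: fps_mult_nth)
qed

lemma fps_power_nth_add_ge: "(A $ 0) ^ j * (A ^ k) $ r \<le> (A ^ (k + j)) $ r"
proof (induction j)
  case (Suc j)
  have "(A $ 0) ^ Suc j * (A ^ k) $ r \<le> A $ 0 * (A ^ (k + j)) $ r"
    using Suc A0 by (simp add: mult.assoc mult_left_mono)
  then show ?case using fps_power_nth_Suc_ge[of "k + j" r] by simp
qed auto

text \<open>In terms of weighted index sequences: an entry of mean \<open>r / (k + 1)\<close>
  vanishes with probability at least \<open>1 - r / (k + 1)\<close>, and the right-hand side is the
  total weight of the sequences in which it vanishes.\<close>

lemma fps_power_nth_Suc_le:
  "(1 - real r / real (Suc k)) * (A ^ Suc k) $ r \<le> A $ 0 * (A ^ k) $ r"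
proof -
  have "(A ^ Suc k) $ r = (\<Sum>s=0..r. A $ s * (A ^ k) $ (r - s))"
    by (simp add: fps_mult_nth)
  also have "\<dots> = A $ 0 * (A ^ k) $ r + (\<Sum>s=Suc 0..r. A $ s * (A ^ k) $ (r - s))"
    by (simp add: sum.atLeast_Suc_atMost)
  \<comment> \<open>Markov's inequality: the terms with \<open>s \<ge> 1\<close> are at most the first moment.\<close>
  also have "(\<Sum>s=Suc 0..r. A $ s * (A ^ k) $ (r - s))
      \<le> (\<Sum>s=Suc 0..r. real s * A $ s * (A ^ k) $ (r - s))"
  proof (rule sum_mono)
    fix s assume "s \<in> {Suc 0..r}"
    then have "1 * (A $ s * (A ^ k) $ (r - s)) \<le> real s * (A $ s * (A ^ k) $ (r - s))"
      by (intro mult_right_mono) (auto simp: nonneg fps_power_nth_nonneg)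
    then show "A $ s * (A ^ k) $ (r - s) \<le> real s * A $ s * (A ^ k) $ (r - s)"
      by (simp add: mult_ac)
  qed
  also have "\<dots> = (\<Sum>s=0..r. real s * A $ s * (A ^ k) $ (r - s))"
    by (simp add: sum.atLeast_Suc_atMost)
  also have "\<dots> = real r / real (Suc k) * (A ^ Suc k) $ r"
    using fps_power_nth_first_moment[of r k] by (simp add: field_simps del: of_nat_Suc power_Suc)
  finally show ?thesis by (simp add: algebra_simps)
qed

text \<open>Only the term \<open>s = 1\<close> of the first moment is kept. This gives a step along
  the diagonal between \<open>(k + 1, r + 1)\<close> and \<open>(k, r)\<close>.\<close>

lemma fps_power_nth_diag_le:
  "real (Suc k) * A $ 1 * (A ^ k) $ r \<le> real (Suc r) * (A ^ Suc k) $ Suc r"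
proof -
  have "(\<Sum>s\<in>{1}. real s * A $ s * (A ^ k) $ (Suc r - s))
      \<le> (\<Sum>s=0..Suc r. real s * A $ s * (A ^ k) $ (Suc r - s))"
    by (rule sum_mono2) (auto simp: nonneg fps_power_nth_nonneg)
  then show ?thesis
    by (subst fps_power_nth_first_moment) (simp add: mult.assoc mult_left_mono)
qed

lemma fps_power_nth_pos: "r \<le> k \<Longrightarrow> (A ^ k) $ r > 0"
proof (induction r arbitrary: k)
  case 0
  then show ?case using A0 by (simp add: fps_power_zeroth_eq_one fps_power_zeroth)
next
  case (Suc r)
  then obtain k' where k: "k = Suc k'" by (cases k) auto
  have "0 < real (Suc k') * A $ 1 * (A ^ k') $ r" using Suc k A1 by auto
  also note fps_power_nth_diag_le
  finally show ?case using k zero_less_mult_pos by (metis of_nat_0_less_iff zero_less_Suc)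
qed

text \<open>Two moves are combined: \<open>fps_power_nth_Suc_le\<close> lowers the exponent at fixed
  \<open>r\<close>, then \<open>fps_power_nth_diag_le\<close> goes up the diagonal. The resulting
  ratio is \<open>A $ 0 * (r + 1) / (A $ 1 * (k - r))\<close>; \<open>q\<close> is any upper bound
  for it, so that one \<open>q\<close> can serve many indices.\<close>

lemma fps_power_nth_pred_le:
  assumes q: "A $ 0 * real (Suc r) \<le> q * A $ 1 * (real k - real r)" and r: "Suc r \<le> k"
  shows "(A ^ k) $ r \<le> q * (A ^ k) $ Suc r"
proof -
  obtain k' where k: "k = Suc k'" using r by (cases k) auto
  have "(A $ 1 * (real k - real r)) * (A ^ k) $ r
      = A $ 1 * real k * ((1 - real r / real (Suc k')) * (A ^ Suc k') $ r)"
    using k by (simp add: field_simps)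
  also have "\<dots> \<le> A $ 1 * real k * (A $ 0 * (A ^ k') $ r)"
    using A1 by (intro mult_left_mono fps_power_nth_Suc_le) auto
  also have "\<dots> = A $ 0 * (real (Suc k') * A $ 1 * (A ^ k') $ r)" using k by (simp add: mult_ac)
  also have "\<dots> \<le> A $ 0 * (real (Suc r) * (A ^ Suc k') $ Suc r)"
    using A0 by (intro mult_left_mono fps_power_nth_diag_le) auto
  also have "\<dots> = (A $ 0 * real (Suc r)) * (A ^ k) $ Suc r" using k by simp
  also have "\<dots> \<le> (q * A $ 1 * (real k - real r)) * (A ^ k) $ Suc r"
    using q by (intro mult_right_mono fps_power_nth_nonneg)
  also have "\<dots> = (A $ 1 * (real k - real r)) * (q * (A ^ k) $ Suc r)" by simp
  finally show ?thesis using A1 r by (subst (asm) mult_le_cancel_left_pos) auto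
qed

text \<open>The ratio in \<open>fps_power_nth_pred_le\<close> grows with the index, so the
  hypothesis on \<open>q\<close>, which is the case of index \<open>r - 1\<close>, covers all
  \<open>s\<close> steps.\<close>

lemma fps_power_nth_shift_le:
  assumes q: "A $ 0 * real r \<le> q * A $ 1 * (real k - real r + 1)" "q \<ge> 0"
    and r: "s \<le> r" "r \<le> k"
  shows "(A ^ k) $ (r - s) \<le> q ^ s * (A ^ k) $ r"
  using r
proof (induction s)
  case (Suc s)
  have "(A ^ k) $ (r - Suc s) \<le> q * (A ^ k) $ Suc (r - Suc s)"
  proof (rule fps_power_nth_pred_le)
    have "A $ 0 * real (Suc (r - Suc s)) \<le> A $ 0 * real r"
      using Suc.prems A0 by (intro mult_left_mono) auto
    also note q(1)
    also have "q * A $ 1 * (real k - real r + 1) \<le> q * A $ 1 * (real k - real (r - Suc s))"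
      using Suc.prems A1 q by (intro mult_left_mono) auto
    finally show "A $ 0 * real (Suc (r - Suc s)) \<le> q * A $ 1 * (real k - real (r - Suc s))" .
    show "Suc (r - Suc s) \<le> k" using Suc.prems by auto
  qed
  also have "\<dots> \<le> q * (q ^ s * (A ^ k) $ r)"
    using Suc q by (intro mult_left_mono) (auto simp: Suc_diff_Suc)
  finally show ?case by simp
qed auto

lemma fps_power_nth_Suc_shift_le:
  assumes q: "A $ 0 * real r \<le> q * A $ 1 * (real (Suc k) - real r + 1)" "q \<ge> 0"
    and r: "s \<le> r" "r \<le> Suc k"
  shows "(A ^ k) $ (r - s) \<le> q ^ s / A $ 0 * (A ^ Suc k) $ r"
proof -
  have "A $ 0 * (A ^ k) $ (r - s) \<le> (A ^ Suc k) $ (r - s)" by (rule fps_power_nth_Suc_ge)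
  also have "\<dots> \<le> q ^ s * (A ^ Suc k) $ r" by (rule fps_power_nth_shift_le[OF q r])
  finally show ?thesis using A0 by (simp add: field_simps)
qed

text \<open>In the first moment the terms with \<open>s \<ge> 2\<close> add up to at most
  \<open>E\<close> times the coefficient, by the upper bound on shifted coefficients. Hence
  \<open>fps_power_nth_diag_le\<close> is sharp up to a relative error
  \<open>(k + 1) E / (r + 1)\<close>.\<close>

lemma fps_power_nth_diag_ge:
  assumes q: "A $ 0 * real (Suc r) \<le> q * A $ 1 * (real k - real r + 1)" "q \<ge> 0"
    and r: "r \<le> k" and E: "(\<Sum>s=2..Suc r. real s * A $ s * q ^ s) \<le> A $ 0 * E"
  shows "(real (Suc r) - real (Suc k) * E) * (A ^ Suc k) $ Suc r
    \<le> real (Suc k) * A $ 1 * (A ^ k) $ r"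
proof -
  let ?c = "(A ^ Suc k) $ Suc r"
  have "(\<Sum>s=0..Suc r. real s * A $ s * (A ^ k) $ (Suc r - s))
     = A $ 1 * (A ^ k) $ r + (\<Sum>s=2..Suc r. real s * A $ s * (A ^ k) $ (Suc r - s))"
    by (simp add: sum.atLeast_Suc_atMost numeral_2_eq_2 del: sum.cl_ivl_Suc)
  also have "(\<Sum>s=2..Suc r. real s * A $ s * (A ^ k) $ (Suc r - s))
      \<le> (\<Sum>s=2..Suc r. real s * A $ s * (q ^ s / A $ 0 * ?c))"
  proof (intro sum_mono mult_left_mono)
    fix s assume "s \<in> {2..Suc r}"
    then show "(A ^ k) $ (Suc r - s) \<le> q ^ s / A $ 0 * ?c"
      using q r by (intro fps_power_nth_Suc_shift_le) auto
  qed (auto simp: nonneg)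
  also have "\<dots> = (\<Sum>s=2..Suc r. real s * A $ s * q ^ s) * (?c / A $ 0)"
    unfolding sum_distrib_right by (intro sum.cong) auto
  also have "\<dots> \<le> A $ 0 * E * (?c / A $ 0)"
    using A0 by (intro mult_right_mono E divide_nonneg_pos fps_power_nth_nonneg)
  also have "\<dots> = E * ?c" using A0 by simp
  finally have "(\<Sum>s=0..Suc r. real s * A $ s * (A ^ k) $ (Suc r - s))
      \<le> A $ 1 * (A ^ k) $ r + E * ?c" by simp
  then have "real (Suc r) * ?c \<le> real (Suc k) * (A $ 1 * (A ^ k) $ r + E * ?c)"
    by (subst fps_power_nth_first_moment) (rule mult_left_mono, auto)
  then show ?thesis by (simp add: algebra_simps del: power_Suc)
qed

text \<open>The difference \<open>k - r\<close> is constant along the diagonal, so the same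
  \<open>q\<close> and \<open>E\<close> serve at every step, and \<open>d\<close> lies below every
  factor \<open>(r - j) - (k - j) E\<close> that occurs.\<close>

lemma fps_power_nth_diag_iter_ge:
  assumes q: "A $ 0 * real r \<le> q * A $ 1 * (real k - real r + 1)" "q \<ge> 0"
    and r: "s \<le> r" "r \<le> k" and E: "(\<Sum>j=2..r. real j * A $ j * q ^ j) \<le> A $ 0 * E" "E \<ge> 0"
    and d: "d \<ge> 0" "d \<le> real r - real s - real k * E"
  shows "d ^ s * (A ^ k) $ r \<le> (real k * A $ 1) ^ s * (A ^ (k - s)) $ (r - s)"
  using r d
proof (induction s)
  case (Suc s)
  define k' r' where "k' = k - Suc s" and "r' = r - Suc s"
  have ks: "k - s = Suc k'" "r - s = Suc r'" using Suc.prems by (auto simp: k'_def r'_def)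
  have kr: "real k' - real r' = real k - real r" using Suc.prems by (auto simp: k'_def r'_def)
  have "d ^ Suc s * (A ^ k) $ r \<le> d * ((real k * A $ 1) ^ s * (A ^ (k - s)) $ (r - s))"
    using Suc by (simp add: mult.assoc mult_left_mono)
  also have "\<dots> = (real k * A $ 1) ^ s * (d * (A ^ Suc k') $ Suc r')"
    by (simp add: ks)
  also have "\<dots> \<le> (real k * A $ 1) ^ s * (real k * A $ 1 * (A ^ k') $ r')"
  proof (rule mult_left_mono)
    have "d \<le> real (Suc r') - real (Suc k') * E"
    proof -
      have "real (Suc k') * E \<le> real k * E"
        using E Suc.prems by (intro mult_right_mono) (auto simp: k'_def)
      then show ?thesis using Suc.prems by (auto simp: r'_def)
    qed
    then have "d * (A ^ Suc k') $ Suc r'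
        \<le> (real (Suc r') - real (Suc k') * E) * (A ^ Suc k') $ Suc r'"
      using fps_power_nth_nonneg by (intro mult_right_mono)
    also have "\<dots> \<le> real (Suc k') * A $ 1 * (A ^ k') $ r'"
    proof (rule fps_power_nth_diag_ge)
      have "A $ 0 * real (Suc r') \<le> A $ 0 * real r"
        using A0 Suc.prems by (intro mult_left_mono) (auto simp: r'_def)
      then show "A $ 0 * real (Suc r') \<le> q * A $ 1 * (real k' - real r' + 1)"
        using q kr by auto
      show "r' \<le> k'" using Suc.prems by (auto simp: k'_def r'_def)
      have "(\<Sum>s=2..Suc r'. real s * A $ s * q ^ s) \<le> (\<Sum>s=2..r. real s * A $ s * q ^ s)"
        using q Suc.prems by (intro sum_mono2) (auto simp: nonneg r'_def)
      then show "(\<Sum>s=2..Suc r'. real s * A $ s * q ^ s) \<le> A $ 0 * E" using E by simp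
    qed fact
    also have "\<dots> \<le> real k * A $ 1 * (A ^ k') $ r'"
      using A1 Suc.prems fps_power_nth_nonneg by (intro mult_right_mono) (auto simp: k'_def)
    finally show "d * (A ^ Suc k') $ Suc r' \<le> real k * A $ 1 * (A ^ k') $ r'" .
  qed (use A1 in auto)
  finally show ?case by (simp add: k'_def r'_def mult_ac)
qed auto

text \<open>Going \<open>s\<close> steps down the diagonal leads from \<open>(k + 1, r)\<close> to
  \<open>(k + 1 - s, r - s)\<close>; raising the exponent back to \<open>k\<close> takes
  \<open>s - 1\<close> steps, each with a factor \<open>A $ 0\<close>. For \<open>d\<close> close to
  \<open>r\<close> and small \<open>r / k\<close> this matches the upper bound
  \<open>q ^ s / A $ 0\<close> of \<open>fps_power_nth_Suc_shift_le\<close>.\<close>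

lemma fps_power_nth_shift_ge:
  assumes q: "A $ 0 * real r \<le> q * A $ 1 * (real (Suc k) - real r + 1)" "q \<ge> 0"
    and r: "1 \<le> s" "s \<le> r" "r \<le> Suc k"
    and E: "(\<Sum>j=2..r. real j * A $ j * q ^ j) \<le> A $ 0 * E" "E \<ge> 0"
    and d: "d \<ge> 0" "d \<le> real r - real s - real (Suc k) * E"
  shows "(A $ 0) ^ (s - 1) * (d / (real (Suc k) * A $ 1)) ^ s * (A ^ Suc k) $ r \<le> (A ^ k) $ (r - s)"
proof -
  have "d ^ s * (A ^ Suc k) $ r \<le> (real (Suc k) * A $ 1) ^ s * (A ^ (Suc k - s)) $ (r - s)"
    by (rule fps_power_nth_diag_iter_ge[OF q r(2,3) E d])
  then have "(d / (real (Suc k) * A $ 1)) ^ s * (A ^ Suc k) $ r \<le> (A ^ (Suc k - s)) $ (r - s)"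
    using A1 by (simp add: power_divide field_simps del: of_nat_Suc power_Suc)
  then have "(A $ 0) ^ (s - 1) * ((d / (real (Suc k) * A $ 1)) ^ s * (A ^ Suc k) $ r)
      \<le> (A $ 0) ^ (s - 1) * (A ^ (Suc k - s)) $ (r - s)"
    using A0 by (intro mult_left_mono) (auto intro: zero_le_power)
  also have "\<dots> \<le> (A ^ (Suc k - s + (s - 1))) $ (r - s)" by (rule fps_power_nth_add_ge)
  also have "Suc k - s + (s - 1) = k" using r by auto
  finally show ?thesis by (simp add: mult.assoc)
qed

end

section \<open>Tilting some of the coefficients\<close>

definition tilt :: "real fps \<Rightarrow> nat set \<Rightarrow> real \<Rightarrow> real fps" where
  "tilt A T v = Abs_fps (\<lambda>s. if s \<in> T then v * A $ s else A $ s)"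

lemma tilt_nth: "tilt A T v $ s = (if s \<in> T then v * A $ s else A $ s)"
  by (simp add: tilt_def)

lemma tilt_1 [simp]: "tilt A T 1 = A"
  by (simp add: fps_eq_iff tilt_nth)

lemma has_real_derivative_tilt_power:
  "((\<lambda>v. (tilt A T v ^ k) $ r) has_real_derivative
     real k * (\<Sum>s=0..r. if s \<in> T then A $ s * (tilt A T v ^ (k - 1)) $ (r - s) else 0)) (at v)"
proof -
  \<comment> \<open>\<open>B\<close> is the derivative of \<open>tilt A T v\<close> with respect to
    \<open>v\<close>; the claim is the power rule, by induction on \<open>k\<close>.\<close>
  define B where "B = Abs_fps (\<lambda>s. if s \<in> T then A $ s else 0)"
  have "((\<lambda>v. (tilt A T v ^ k) $ r) has_real_derivative
     (fps_const (real k) * B * tilt A T v ^ (k - 1)) $ r) (at v)"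
  proof (induction k arbitrary: r)
    case (Suc k)
    have 1: "((\<lambda>v. tilt A T v $ i) has_real_derivative B $ i) (at v)" for i
      by (auto simp: tilt_nth B_def intro!: derivative_eq_intros)
    have "((\<lambda>v. \<Sum>i=0..r. tilt A T v $ i * (tilt A T v ^ k) $ (r - i)) has_real_derivative
      (\<Sum>i=0..r. B $ i * (tilt A T v ^ k) $ (r - i)
        + (fps_const (real k) * B * tilt A T v ^ (k - 1)) $ (r - i) * tilt A T v $ i)) (at v)"
      by (intro DERIV_sum DERIV_mult 1 Suc)
    also have "(\<lambda>v. \<Sum>i=0..r. tilt A T v $ i * (tilt A T v ^ k) $ (r - i))
      = (\<lambda>v. (tilt A T v ^ Suc k) $ r)"
      by (simp add: fps_mult_nth)
    also have "(\<Sum>i=0..r. B $ i * (tilt A T v ^ k) $ (r - i)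
        + (fps_const (real k) * B * tilt A T v ^ (k - 1)) $ (r - i) * tilt A T v $ i)
      = (B * tilt A T v ^ k + tilt A T v * (fps_const (real k) * B * tilt A T v ^ (k - 1))) $ r"
      by (simp only: fps_add_nth fps_mult_nth[of B] fps_mult_nth[of "tilt A T v"] sum.distrib mult.commute)
    also have "B * tilt A T v ^ k + tilt A T v * (fps_const (real k) * B * tilt A T v ^ (k - 1))
      = fps_const (real (Suc k)) * B * tilt A T v ^ k"
    proof (cases k)
      case (Suc j)
      have "fps_const (real (Suc k)) = fps_const (real k) + 1"
        by (simp add: fps_eq_iff)
      then show ?thesis using Suc by (simp only:) (simp add: algebra_simps)
    qed auto
    finally show ?case by simp
  qed auto
  also have "(fps_const (real k) * B * tilt A T v ^ (k - 1)) $ r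
    = real k * (\<Sum>s=0..r. if s \<in> T then A $ s * (tilt A T v ^ (k - 1)) $ (r - s) else 0)"
    unfolding mult.assoc fps_mult_left_const_nth
    by (simp add: fps_mult_nth B_def if_distrib[of "\<lambda>x. x * _"] cong: if_cong)
  finally show ?thesis .
qed

text \<open>Gronwall's inequality: \<open>f x * exp (-U * x)\<close> is nonincreasing. The
  differential inequality is asked only in the open interval, so that an endpoint may be the tilt
  \<open>0\<close>.\<close>

lemma exp_growth_le:
  fixes f :: "real \<Rightarrow> real"
  assumes d: "\<And>x. u < x \<Longrightarrow> x < v \<Longrightarrow> (f has_real_derivative f' x) (at x)"
    and c: "continuous_on {u..v} f"
    and le: "\<And>x. u < x \<Longrightarrow> x < v \<Longrightarrow> f' x \<le> U * f x" and uv: "u \<le> v"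
  shows "f v \<le> f u * exp (U * (v - u))"
proof (cases "u = v")
  case False
  have "f v * exp (-U * v) \<le> f u * exp (-U * u)"
  proof (rule DERIV_nonpos_imp_decreasing_open[of u v "\<lambda>x. f x * exp (-U * x)"])
    fix x assume x: "u < x" "x < v"
    have "((\<lambda>x. f x * exp (-U * x)) has_real_derivative (f' x - U * f x) * exp (-U * x)) (at x)"
      by (auto intro!: derivative_eq_intros d x simp: algebra_simps)
    moreover have "(f' x - U * f x) * exp (-U * x) \<le> 0"
      using le[OF x] by (intro mult_nonpos_nonneg) auto
    ultimately show "\<exists>y. ((\<lambda>x. f x * exp (-U * x)) has_real_derivative y) (at x) \<and> y \<le> 0" by blast
  qed (use uv c in \<open>auto intro!: continuous_intros\<close>)
  then have "f v * exp (-U * v) * exp (U * v) \<le> f u * exp (-U * u) * exp (U * v)"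
    by (intro mult_right_mono) auto
  then show ?thesis by (simp add: mult.assoc exp_add[symmetric] algebra_simps)
qed auto

context
  fixes A :: "real fps"
  assumes nonneg: "\<And>i. A $ i \<ge> 0" and A0: "A $ 0 > 0" and A1: "A $ 1 > 0"
begin

text \<open>The upper half of the bound on the logarithmic derivative. The tilt leaves coefficient 0
  alone and does not lower coefficient 1, so a \<open>q\<close> chosen for \<open>A\<close> also
  works for the tilted series, and \<open>U\<close> is independent of \<open>v\<close>.\<close>

lemma tilt_power_Suc_deriv_le:
  assumes q: "A $ 0 * real r \<le> q * A $ 1 * (real (Suc k) - real r + 1)" "q \<ge> 0"
    and r: "r \<le> Suc k"
    and T: "0 \<notin> T" "v \<ge> 1 \<or> 1 \<notin> T" and v: "v > 0"
    and U: "real (Suc k) * (\<Sum>s=0..r. if s \<in> T then A $ s * q ^ s else 0) \<le> A $ 0 * U"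
  shows "real (Suc k) * (\<Sum>s=0..r. if s \<in> T then A $ s * (tilt A T v ^ k) $ (r - s) else 0)
    \<le> U * (tilt A T v ^ Suc k) $ r"
proof -
  let ?c = "(tilt A T v ^ Suc k) $ r"
  have tilt: "\<And>i. tilt A T v $ i \<ge> 0" "tilt A T v $ 0 > 0" "tilt A T v $ 1 > 0"
    using v A0 A1 nonneg by (auto simp: tilt_nth)
  have A0': "tilt A T v $ 0 = A $ 0" using T by (simp add: tilt_nth)
  have A1': "tilt A T v $ 1 \<ge> A $ 1"
    using T A1 mult_right_mono[of 1 v "A $ 1"] by (auto simp: tilt_nth)
  have "A $ 0 * real r \<le> q * A $ 1 * (real (Suc k) - real r + 1)" by fact
  also have "\<dots> \<le> q * tilt A T v $ 1 * (real (Suc k) - real r + 1)"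
    using A1' q r by (intro mult_right_mono mult_left_mono) auto
  finally have q': "tilt A T v $ 0 * real r \<le> \<dots>" by (simp add: A0')
  have "(\<Sum>s=0..r. if s \<in> T then A $ s * (tilt A T v ^ k) $ (r - s) else 0)
    \<le> (\<Sum>s=0..r. if s \<in> T then A $ s * (q ^ s / A $ 0 * ?c) else 0)"
  proof (rule sum_mono)
    fix s assume "s \<in> {0..r}"
    then have "(tilt A T v ^ k) $ (r - s) \<le> q ^ s / A $ 0 * ?c"
      using fps_power_nth_Suc_shift_le[OF tilt q' q(2) _ r, of s] A0' by simp
    then have "A $ s * (tilt A T v ^ k) $ (r - s) \<le> A $ s * (q ^ s / A $ 0 * ?c)"
      by (rule mult_left_mono[OF _ nonneg])
    then show "(if s \<in> T then A $ s * (tilt A T v ^ k) $ (r - s) else 0)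
      \<le> (if s \<in> T then A $ s * (q ^ s / A $ 0 * ?c) else 0)"
      by (cases "s \<in> T") (simp_all only: if_True if_False order_refl)
  qed
  also have "\<dots> = (\<Sum>s=0..r. if s \<in> T then A $ s * q ^ s else 0) * (?c / A $ 0)"
    unfolding sum_distrib_right by (intro sum.cong) auto
  finally have "real (Suc k) * (\<Sum>s=0..r. if s \<in> T then A $ s * (tilt A T v ^ k) $ (r - s) else 0)
    \<le> real (Suc k) * ((\<Sum>s=0..r. if s \<in> T then A $ s * q ^ s else 0) * (?c / A $ 0))"
    by (rule mult_left_mono) auto
  also have "\<dots> \<le> A $ 0 * U * (?c / A $ 0)"
    unfolding mult.assoc[symmetric] times_divide_eq_right
    using fps_power_nth_nonneg[OF tilt] A0 U by (intro divide_right_mono mult_right_mono) (auto simp del: power_Suc)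
  also have "\<dots> = U * ?c" using A0 by simp
  finally show ?thesis .
qed

text \<open>The factor 2 in the assumption on \<open>q\<close> absorbs the possible halving of the coefficient 1, which makes
  the bound uniform in \<open>v\<close>.\<close>

lemma tilt_power_Suc_deriv_ge:
  assumes q: "2 * A $ 0 * real r \<le> q * A $ 1 * (real (Suc k) - real r + 1)" "q \<ge> 0"
    and r: "s \<in> T" "s \<le> r" "r \<le> Suc k"
    and T: "0 \<notin> T" and v: "0 < v" "v \<le> 1" "1/2 \<le> v \<or> 1 \<notin> T"
    and E: "(\<Sum>j=2..r. real j * A $ j * q ^ j) \<le> A $ 0 * E" "E \<ge> 0"
    and d: "d \<ge> 0" "d \<le> real r - real s - real (Suc k) * E"
    and L: "L \<le> real (Suc k) * A $ s * (A $ 0) ^ (s - 1) * (d / (real (Suc k) * A $ 1)) ^ s"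
  shows "L * (tilt A T v ^ Suc k) $ r
    \<le> real (Suc k) * (\<Sum>s=0..r. if s \<in> T then A $ s * (tilt A T v ^ k) $ (r - s) else 0)"
proof -
  let ?c = "(tilt A T v ^ Suc k) $ r"
  have tilt: "\<And>i. tilt A T v $ i \<ge> 0" "tilt A T v $ 0 > 0" "tilt A T v $ 1 > 0"
    using v A0 A1 nonneg by (auto simp: tilt_nth)
  have A0': "tilt A T v $ 0 = A $ 0" using T by (simp add: tilt_nth)
  have A1': "tilt A T v $ 1 \<le> A $ 1"
    using A1 v by (auto simp: tilt_nth mult_left_le_one_le)
  have A1'': "A $ 1 \<le> 2 * tilt A T v $ 1"
    using A1 v by (auto simp: tilt_nth)
  have s1: "s \<ge> 1" using r T by (cases s) auto
  have "2 * A $ 0 * real r \<le> q * A $ 1 * (real (Suc k) - real r + 1)" by fact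
  also have "\<dots> \<le> q * (2 * tilt A T v $ 1) * (real (Suc k) - real r + 1)"
    using A1'' q r by (intro mult_right_mono mult_left_mono) auto
  finally have q': "tilt A T v $ 0 * real r \<le> q * tilt A T v $ 1 * (real (Suc k) - real r + 1)"
    by (simp add: A0')
  \<comment> \<open>Since \<open>v \<le> 1\<close>, tilting only lowers coefficients, so the error
    \<open>E\<close> computed for \<open>A\<close> stays valid.\<close>
  have "(\<Sum>j=2..r. real j * tilt A T v $ j * q ^ j) \<le> (\<Sum>j=2..r. real j * A $ j * q ^ j)"
    using nonneg q v
    by (intro sum_mono mult_right_mono mult_left_mono) (auto simp: tilt_nth mult_left_le_one_le)
  with E A0' have E': "(\<Sum>j=2..r. real j * tilt A T v $ j * q ^ j) \<le> tilt A T v $ 0 * E" by simp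
  have "L * ?c \<le> real (Suc k) * A $ s * (A $ 0) ^ (s - 1) * (d / (real (Suc k) * A $ 1)) ^ s * ?c"
    using fps_power_nth_nonneg[OF tilt] L by (intro mult_right_mono)
  also have "\<dots> \<le> real (Suc k) * A $ s * (A $ 0) ^ (s - 1) * (d / (real (Suc k) * tilt A T v $ 1)) ^ s * ?c"
    using fps_power_nth_nonneg[OF tilt] nonneg A0 A1' A1 d tilt
    by (intro mult_right_mono mult_left_mono power_mono divide_left_mono mult_nonneg_nonneg
      divide_nonneg_nonneg zero_le_power mult_pos_pos) (auto simp del: power_Suc)
  also have "\<dots> = real (Suc k) * (A $ s * ((A $ 0) ^ (s - 1) *
      (d / (real (Suc k) * tilt A T v $ 1)) ^ s * ?c))"
    by (simp only: mult_ac)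
  also have "\<dots> \<le> real (Suc k) * (A $ s * (tilt A T v ^ k) $ (r - s))"
    using fps_power_nth_shift_ge[OF tilt q' q(2) s1 r(2,3) E' E(2) d] nonneg
    by (intro mult_left_mono) (auto simp: A0' simp del: power_Suc)
  \<comment> \<open>For a lower bound, one index \<open>s\<close> of \<open>T\<close> is enough; the
    other summands are nonnegative.\<close>
  also have "A $ s * (tilt A T v ^ k) $ (r - s)
      = (\<Sum>s\<in>{s}. if s \<in> T then A $ s * (tilt A T v ^ k) $ (r - s) else 0)" using r by simp
  also have "\<dots> \<le> (\<Sum>s=0..r. if s \<in> T then A $ s * (tilt A T v ^ k) $ (r - s) else 0)"
    using r nonneg fps_power_nth_nonneg[OF tilt] by (intro sum_mono2) auto
  finally show ?thesis by (simp add: mult_left_mono)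
qed

lemma continuous_on_tilt_power: "continuous_on S (\<lambda>v. (tilt A T v ^ k) $ r)"
  by (intro continuous_at_imp_continuous_on ballI DERIV_isCont[OF has_real_derivative_tilt_power])

text \<open>The derivative bound asks for a positive tilt, but it is applied only strictly between
  \<open>u\<close> and \<open>v\<close>; this admits \<open>u = 0\<close>.\<close>

lemma tilt_power_growth_le:
  assumes q: "A $ 0 * real r \<le> q * A $ 1 * (real k - real r + 1)" "q \<ge> 0"
    and r: "r \<le> k" "k > 0"
    and T: "0 \<notin> T" "u \<ge> 1 \<or> u \<ge> 0 \<and> 1 \<notin> T"
    and U: "real k * (\<Sum>s=0..r. if s \<in> T then A $ s * q ^ s else 0) \<le> A $ 0 * U"
    and uv: "u \<le> v"
  shows "(tilt A T v ^ k) $ r \<le> (tilt A T u ^ k) $ r * exp (U * (v - u))"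
proof -
  obtain k' where k: "k = Suc k'" using r by (cases k) auto
  show ?thesis
  proof (rule exp_growth_le[OF has_real_derivative_tilt_power continuous_on_tilt_power _ uv])
    fix x assume "u < x" "x < v"
    then show "real k * (\<Sum>s=0..r. if s \<in> T then A $ s * (tilt A T x ^ (k - 1)) $ (r - s) else 0)
      \<le> U * (tilt A T x ^ k) $ r"
      using tilt_power_Suc_deriv_le[of r q k' T x U] assms unfolding k diff_Suc_1
      by (auto simp del: power_Suc)
  qed
qed

lemma tilt_power_growth_ge:
  assumes q: "2 * A $ 0 * real r \<le> q * A $ 1 * (real k - real r + 1)" "q \<ge> 0"
    and r: "s \<in> T" "s \<le> r" "r \<le> k" "k > 0"
    and T: "0 \<notin> T" and v: "0 \<le> u" "u \<le> v" "v \<le> 1" "1/2 \<le> u \<or> 1 \<notin> T"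
    and E: "(\<Sum>j=2..r. real j * A $ j * q ^ j) \<le> A $ 0 * E" "E \<ge> 0"
    and d: "d \<ge> 0" "d \<le> real r - real s - real k * E"
    and L: "L \<le> real k * A $ s * (A $ 0) ^ (s - 1) * (d / (real k * A $ 1)) ^ s"
  shows "(tilt A T u ^ k) $ r \<le> (tilt A T v ^ k) $ r * exp (- L * (v - u))"
proof -
  obtain k' where k: "k = Suc k'" using r by (cases k) auto
  \<comment> \<open>Gronwall bounds growth from above, so the lower bound on the derivative is
    applied to the negated coefficient.\<close>
  have "- ((tilt A T v ^ k) $ r) \<le> - ((tilt A T u ^ k) $ r) * exp (L * (v - u))"
  proof (rule exp_growth_le[OF DERIV_minus[OF has_real_derivative_tilt_power]
        continuous_on_minus[OF continuous_on_tilt_power] _ v(2)])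
    fix x assume "u < x" "x < v"
    then show "- (real k * (\<Sum>s=0..r. if s \<in> T then A $ s * (tilt A T x ^ (k - 1)) $ (r - s) else 0))
      \<le> L * - ((tilt A T x ^ k) $ r)"
      using tilt_power_Suc_deriv_ge[of r q k' s T x E d L] assms unfolding k diff_Suc_1
      by (auto simp del: power_Suc)
  qed
  then have "(tilt A T u ^ k) $ r * exp (L * (v - u)) * exp (- L * (v - u))
      \<le> (tilt A T v ^ k) $ r * exp (- L * (v - u))"
    by (intro mult_right_mono) auto
  then show ?thesis by (simp add: mult.assoc exp_add[symmetric])
qed

end

section \<open>Enumeration of assemblies\<close>

text \<open>The partial Bell polynomial in the values of \<open>f\<close>, taken over an arbitrary
  set \<open>S\<close> so that the recursion can remove a block.\<close>

definition partition_weight :: "(nat \<Rightarrow> real) \<Rightarrow> 'a set \<Rightarrow> nat \<Rightarrow> real" where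
  "partition_weight f S k = (\<Sum>P | partition_on S P \<and> card P = k. \<Prod>B\<in>P. f (card B))"

lemma finite_partitions: "finite S \<Longrightarrow> finite {P. partition_on S P \<and> Q P}"
  by (rule finite_subset[of _ "Pow (Pow S)"]) (auto simp: partition_on_def)

lemma partition_on_remove:
  assumes "partition_on S P" "B \<in> P"
  shows "partition_on (S - B) (P - {B})"
proof (rule partition_onI)
  have "disjoint P" using assms by (auto simp: partition_on_def)
  then have "\<And>C. C \<in> P - {B} \<Longrightarrow> C \<inter> B = {}" using assms by (auto simp: disjoint_def)
  then show "\<Union>(P - {B}) = S - B" using assms by (auto simp: partition_on_def)
  show "disjnt p q" if "p \<in> P - {B}" "q \<in> P - {B}" "p \<noteq> q" for p q
    using \<open>disjoint P\<close> that by (auto simp: disjoint_def disjnt_def)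
  show "{} \<notin> P - {B}"
    using assms by (auto simp: partition_on_def)
qed

lemma partition_on_add:
  assumes "partition_on (S - B) P" "B \<noteq> {}" "B \<subseteq> S"
  shows "partition_on S (insert B P)" "B \<notin> P"
  using assms by (auto simp: partition_on_def disjoint_def)

text \<open>Double counting of the pairs of a partition \<open>P\<close> and a block
  \<open>B\<close> of it: each \<open>P\<close> has \<open>k + 1\<close> blocks, and removing
  \<open>B\<close> leaves a partition of \<open>S - B\<close> into \<open>k\<close> blocks.\<close>

lemma partition_weight_Suc:
  assumes "finite S"
  shows "real (Suc k) * partition_weight f S (Suc k)
    = (\<Sum>B\<in>Pow S - {{}}. f (card B) * partition_weight f (S - B) k)"
proof -
  let ?Q = "\<lambda>S k. {P. partition_on S P \<and> card P = k}"
  have fin: "finite P" if "P \<in> ?Q S (Suc k)" for P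
    using that by (auto intro: card_ge_0_finite)
  have "(\<Sum>B\<in>Pow S - {{}}. f (card B) * partition_weight f (S - B) k)
    = (\<Sum>(B, P)\<in>(SIGMA B:Pow S - {{}}. ?Q (S - B) k). f (card B) * (\<Prod>C\<in>P. f (card C)))"
    unfolding partition_weight_def sum_distrib_left
    using assms by (intro sum.Sigma) (simp_all add: finite_partitions)
  also have "\<dots> = (\<Sum>(P, B)\<in>(SIGMA P:?Q S (Suc k). P). \<Prod>C\<in>P. f (card C))"
  proof (rule sum.reindex_bij_witness[where i = "\<lambda>(P, B). (B, P - {B})" and j = "\<lambda>(B, P). (insert B P, B)"],
      goal_cases)
    case (1 x)
    then show ?case by (auto simp: partition_on_def)
  next
    case (2 x)
    obtain B P where x: "x = (B, P)" by (cases x)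
    have "partition_on S (insert B P)" "B \<notin> P" using partition_on_add[of S B P] 2 x by auto
    moreover have "finite P"
      using finite_elements[of "S - B" P] 2 x assms by auto
    ultimately show ?case using 2 x by auto
  next
    case (3 x)
    then show ?case by auto
  next
    case (4 x)
    obtain P B where x: "x = (P, B)" by (cases x)
    then show ?case using 4 partition_on_remove[of S P B] fin[of P] by (auto simp: partition_on_def)
  next
    case (5 x)
    obtain B P where x: "x = (B, P)" by (cases x)
    have "B \<notin> P" using partition_on_add[of S B P] 5 x by auto
    moreover have "finite P"
      using finite_elements[of "S - B" P] 5 x assms by auto
    ultimately show ?case using x by auto
  qed
  also have "\<dots> = (\<Sum>P\<in>?Q S (Suc k). \<Sum>B\<in>P. \<Prod>C\<in>P. f (card C))"
    using fin by (intro sum.Sigma[symmetric] finite_partitions assms) blast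
  also have "\<dots> = real (Suc k) * partition_weight f S (Suc k)"
    unfolding partition_weight_def sum_distrib_left by (intro sum.cong) auto
  finally show ?thesis by simp
qed

text \<open>The exponential formula. In the recursion the removed blocks are grouped by their size
  \<open>b\<close>, which turns the sum into the convolution for \<open>?F ^ Suc k\<close>.\<close>

lemma partition_weight_eq:
  assumes "finite S"
  shows "partition_weight f S k = fact (card S) / fact k *
    (Abs_fps (\<lambda>i. if i = 0 then 0 else f i / fact i) ^ k) $ card S"
  using assms
proof (induction k arbitrary: S)
  case 0
  have "{P. partition_on S P \<and> card P = 0} = (if S = {} then {{}} else {})"
  proof -
    have "P = {} \<and> S = {}" if "partition_on S P" "card P = 0" for P
      using that finite_elements[OF 0 that(1)] by (auto simp: partition_on_def)
    then show ?thesis by (auto simp: partition_on_def)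
  qed
  then show ?case using 0 by (auto simp: partition_weight_def)
next
  case (Suc k)
  let ?F = "Abs_fps (\<lambda>i. if i = 0 then 0 else f i / fact i)"
  let ?n = "card S"
  have "real (Suc k) * partition_weight f S (Suc k)
    = (\<Sum>B\<in>Pow S - {{}}. f (card B) * partition_weight f (S - B) k)"
    by (rule partition_weight_Suc[OF Suc.prems])
  \<comment> \<open>The factor \<open>1 / (?n choose card B)\<close> will cancel against the number
    of subsets of that size. The empty set can be added because \<open>?F $ 0 = 0\<close>.\<close>
  also have "\<dots> = (\<Sum>B\<in>Pow S. fact ?n / fact k * ((1 / (?n choose card B)) * (?F $ card B * (?F ^ k) $ (?n - card B))))"
  proof (rule sum.mono_neutral_cong_left)
    fix B assume B: "B \<in> Pow S - {{}}"
    have "card B \<le> ?n" using B Suc.prems by (auto intro: card_mono)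
    moreover have "card B \<noteq> 0" using B Suc.prems finite_subset[of B S] by auto
    ultimately show "f (card B) * partition_weight f (S - B) k =
      fact ?n / fact k * ((1 / (?n choose card B)) * (?F $ card B * (?F ^ k) $ (?n - card B)))"
      using Suc B finite_subset[of B S]
      by (simp add: card_Diff_subset binomial_fact field_simps)
  qed (use Suc.prems in auto)
  also have "\<dots> = (\<Sum>b\<in>{0..?n}. \<Sum>B\<in>{B\<in>Pow S. card B = b}.
      fact ?n / fact k * ((1 / (?n choose card B)) * (?F $ card B * (?F ^ k) $ (?n - card B))))"
    using Suc.prems by (intro sum.group[symmetric]) (auto intro: card_mono)
  also have "\<dots> = (\<Sum>b\<in>{0..?n}. fact ?n / fact k * (?F $ b * (?F ^ k) $ (?n - b)))"
  proof (rule sum.cong)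
    fix b assume b: "b \<in> {0..?n}"
    have "(\<Sum>B\<in>{B\<in>Pow S. card B = b}. fact ?n / fact k * ((1 / (?n choose card B)) * (?F $ card B * (?F ^ k) $ (?n - card B))))
      = (\<Sum>B\<in>{B. B \<subseteq> S \<and> card B = b}. fact ?n / fact k * ((1 / (?n choose b)) * (?F $ b * (?F ^ k) $ (?n - b))))"
      by (rule sum.cong) auto
    also have "\<dots> = real (?n choose b) * (fact ?n / fact k * ((1 / (?n choose b)) * (?F $ b * (?F ^ k) $ (?n - b))))"
      using Suc.prems by (simp add: n_subsets)
    also have "\<dots> = fact ?n / fact k * (?F $ b * (?F ^ k) $ (?n - b))"
      using b by simp
    finally show "(\<Sum>B\<in>{B\<in>Pow S. card B = b}. fact ?n / fact k * ((1 / (?n choose card B)) * (?F $ card B * (?F ^ k) $ (?n - card B))))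
      = fact ?n / fact k * (?F $ b * (?F ^ k) $ (?n - b))" .
  qed auto
  also have "\<dots> = fact ?n / fact k * (?F ^ Suc k) $ ?n"
    unfolding sum_distrib_left[symmetric] power_Suc fps_mult_nth ..
  finally have "partition_weight f S (Suc k) = fact ?n / fact k * (?F ^ Suc k) $ ?n / real (Suc k)"
    by (simp add: eq_divide_eq mult_ac del: of_nat_Suc power_Suc)
  then show ?case by (simp del: power_Suc)
qed

section \<open>Weighted counts of assemblies and their components\<close>

lemma sum_assemblies_k:
  "(\<Sum>a\<in>assemblies_k m n k. \<Prod>B\<in>fst a. w (card B))
    = partition_weight (\<lambda>i. real (m i) * w i) {1..n} k"
proof -
  let ?Q = "{P. partition_on {1..n} P \<and> card P = k}"
  let ?D = "\<lambda>P. Pi\<^sub>E P (\<lambda>B. {..<m (card B)})"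
  have fin: "finite P" if "P \<in> ?Q" for P
    using that finite_elements[of "{1..n}" P] by auto
  have "assemblies_k m n k = (SIGMA P:?Q. ?D P)"
    by (auto simp: assemblies_k_def assemblies_def num_components_def)
  then have "(\<Sum>a\<in>assemblies_k m n k. \<Prod>B\<in>fst a. w (card B))
    = (\<Sum>(P, d)\<in>(SIGMA P:?Q. ?D P). \<Prod>B\<in>P. w (card B))"
    by (simp add: case_prod_beta)
  also have "\<dots> = (\<Sum>P\<in>?Q. \<Sum>d\<in>?D P. \<Prod>B\<in>P. w (card B))"
  proof (rule sum.Sigma[symmetric])
    show "finite ?Q" by (rule finite_partitions) simp
    show "\<forall>P\<in>?Q. finite (?D P)" using fin by (blast intro: finite_PiE finite_lessThan)
  qed
  also have "\<dots> = partition_weight (\<lambda>i. real (m i) * w i) {1..n} k"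
    unfolding partition_weight_def
  proof (rule sum.cong)
    fix P assume "P \<in> ?Q"
    then show "(\<Sum>d\<in>?D P. \<Prod>B\<in>P. w (card B)) = (\<Prod>B\<in>P. real (m (card B)) * w (card B))"
      using fin[of P] by (simp add: card_PiE prod.distrib)
  qed simp
  finally show ?thesis .
qed

definition shifted_egf :: "(nat \<Rightarrow> nat) \<Rightarrow> real fps" where
  "shifted_egf m = Abs_fps (\<lambda>s. real (m (Suc s)) / fact (Suc s))"

text \<open>Components are classified by size minus one, matching the indices of
  \<open>shifted_egf\<close>. Blocks of an assembly are nonempty and finite, so the subtraction is
  never truncated.\<close>

definition excess_count :: "nat set \<Rightarrow> assembly \<Rightarrow> nat" where
  "excess_count T a = card {B \<in> fst a. card B - 1 \<in> T}"

lemma assemblies_k_fst: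
  assumes "a \<in> assemblies_k m n k"
  shows "partition_on {1..n} (fst a)" "card (fst a) = k" "finite (fst a)"
    "\<And>B. B \<in> fst a \<Longrightarrow> card B \<ge> 1 \<and> finite B"
proof -
  show *: "partition_on {1..n} (fst a)" "card (fst a) = k"
    using assms by (auto simp: assemblies_k_def assemblies_def num_components_def)
  show "finite (fst a)" using finite_elements[OF _ *(1)] by simp
  fix B assume B: "B \<in> fst a"
  then have "finite B" "B \<noteq> {}" using * finite_subset[of B "{1..n}"]
    by (auto simp: partition_on_def)
  then show "card B \<ge> 1 \<and> finite B" using card_gt_0_iff[of B] by simp
qed

text \<open>Each component with excess in \<open>T\<close> gets weight \<open>v\<close>, so the
  exponential formula applies to \<open>z A_v(z)\<close>; the factor \<open>z^k\<close> in its power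
  shifts the coefficient from \<open>n\<close> to \<open>n - k\<close>.\<close>

lemma sum_assemblies_k_tilt:
  assumes "k \<le> n"
  shows "(\<Sum>a\<in>assemblies_k m n k. v ^ excess_count T a)
    = fact n / fact k * (tilt (shifted_egf m) T v ^ k) $ (n - k)"
proof -
  let ?w = "\<lambda>i. if i - 1 \<in> T then v else 1"
  have "(\<Sum>a\<in>assemblies_k m n k. v ^ excess_count T a)
    = (\<Sum>a\<in>assemblies_k m n k. \<Prod>B\<in>fst a. ?w (card B))"
  proof (rule sum.cong)
    fix a assume "a \<in> assemblies_k m n k"
    then have "finite (fst a)" by (rule assemblies_k_fst)
    then have "(\<Prod>B\<in>fst a. ?w (card B)) = (\<Prod>B\<in>{B\<in>fst a. card B - 1 \<in> T}. v)"
      by (intro prod.mono_neutral_cong_right) auto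
    then show "v ^ excess_count T a = (\<Prod>B\<in>fst a. ?w (card B))"
      by (simp add: excess_count_def)
  qed auto
  also have "\<dots> = fact n / fact k *
    (Abs_fps (\<lambda>i. if i = 0 then 0 else real (m i) * ?w i / fact i) ^ k) $ n"
    unfolding sum_assemblies_k[of ?w] by (subst partition_weight_eq) simp_all
  also have "Abs_fps (\<lambda>i. if i = 0 then 0 else real (m i) * ?w i / fact i)
      = fps_X * tilt (shifted_egf m) T v"
  proof (rule fps_ext)
    fix i show "Abs_fps (\<lambda>i. if i = 0 then 0 else real (m i) * ?w i / fact i) $ i
      = (fps_X * tilt (shifted_egf m) T v) $ i"
      by (cases i) (auto simp: tilt_nth shifted_egf_def)
  qed
  also have "\<dots> ^ k = fps_X ^ k * tilt (shifted_egf m) T v ^ k" by (rule power_mult_distrib)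
  also have "\<dots> $ n = (tilt (shifted_egf m) T v ^ k) $ (n - k)"
    using assms by (simp add: fps_X_power_mult_nth)
  finally show ?thesis .
qed

lemma finite_assemblies_k: "finite (assemblies_k m n k)"
proof (rule finite_subset)
  show "assemblies_k m n k \<subseteq> assemblies m n" by (auto simp: assemblies_k_def)
  show "finite (assemblies m n)"
    unfolding assemblies_def using finite_partitions[of "{1..n}" "\<lambda>_. True"]
    by (auto intro!: finite_SigmaI finite_PiE dest: finite_elements[rotated])
qed

lemma sum_excess: 
  assumes "a \<in> assemblies_k m n k"
  shows "(\<Sum>B\<in>fst a. card B - 1) = n - k"
proof -
  note * = assemblies_k_fst[OF assms]
  have "(\<Sum>B\<in>fst a. card B) = card (\<Union>(fst a))"
    using * by (intro card_Union_disjoint[symmetric]) (auto simp: partition_on_def disjoint_def pairwise_def disjnt_def)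
  also have "\<Union>(fst a) = {1..n}" using * by (auto simp: partition_on_def)
  finally have "(\<Sum>B\<in>fst a. card B) = n" by simp
  moreover have "(\<Sum>B\<in>fst a. card B - 1) = (\<Sum>B\<in>fst a. card B) - (\<Sum>B\<in>fst a. 1)"
    using * by (intro sum_subtractf_nat) auto
  ultimately show ?thesis using * by simp
qed

lemma components_of_size_eq:
  assumes "a \<in> assemblies_k m n k" "i \<ge> 1"
  shows "components_of_size i a = excess_count {i - 1} a"
proof -
  have "\<And>B. B \<in> fst a \<Longrightarrow> card B = i \<longleftrightarrow> card B - 1 = i - 1"
    using assemblies_k_fst(4)[OF assms(1)] assms(2) by fastforce
  then show ?thesis unfolding components_of_size_def excess_count_def
    by (intro arg_cong[of _ _ card]) auto
qed

text \<open>Every component of size at least 2 uses up at least one unit of the total excess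
  \<open>n - k\<close>. This handles singletons, whose index 0 the tilting estimates
  exclude.\<close>

lemma components_of_size_one_bounds:
  assumes "a \<in> assemblies_k m n k"
  shows "components_of_size 1 a \<le> k" "k \<le> components_of_size 1 a + (n - k)"
proof -
  note * = assemblies_k_fst[OF assms]
  let ?L = "{B \<in> fst a. card B \<noteq> 1}"
  have "card (fst a) = card {B \<in> fst a. card B = 1} + card ?L"
    using * by (subst card_Un_disjoint[symmetric]) (auto intro!: arg_cong[of _ _ card])
  moreover have "card ?L \<le> n - k"
  proof -
    have "card ?L = (\<Sum>B\<in>?L. 1)" by simp
    also have "\<dots> \<le> (\<Sum>B\<in>?L. card B - 1)"
    proof (rule sum_mono)
      fix B assume "B \<in> ?L"
      then show "1 \<le> card B - 1" using *(4)[of B] by auto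
    qed
    also have "\<dots> \<le> (\<Sum>B\<in>fst a. card B - 1)" using * by (intro sum_mono2) auto
    also note sum_excess[OF assms]
    finally show ?thesis .
  qed
  ultimately show "components_of_size 1 a \<le> k" "k \<le> components_of_size 1 a + (n - k)"
    using * by (auto simp: components_of_size_def)
qed

text \<open>A size above \<open>j\<close> means an excess of at least \<open>j\<close>, hence the
  set \<open>{j..}\<close>. With \<open>n \<ge> 1\<close> there is a block, so \<open>Max\<close> is
  taken over a nonempty set.\<close>

lemma largest_component_le_iff:
  assumes "a \<in> assemblies_k m n k" "n \<ge> 1"
  shows "largest_component a \<le> j \<longleftrightarrow> excess_count {j..} a = 0"
proof -
  note * = assemblies_k_fst[OF assms(1)]
  have "fst a \<noteq> {}" using * assms(2) by (auto simp: partition_on_def)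
  then have "largest_component a \<le> j \<longleftrightarrow> (\<forall>B\<in>fst a. card B \<le> j)"
    using * unfolding largest_component_def by (subst Max_le_iff) auto
  also have "\<dots> \<longleftrightarrow> {B \<in> fst a. card B - 1 \<in> {j..}} = {}"
    using *(4) by (fastforce simp: not_le)
  also have "\<dots> \<longleftrightarrow> excess_count {j..} a = 0" using *(3) by (simp add: excess_count_def)
  finally show ?thesis .
qed

section \<open>Probabilities in terms of tilted coefficients\<close>

context
  fixes m :: "nat \<Rightarrow> nat" and n k :: nat
  assumes m_pos: "\<And>i. i \<ge> 1 \<Longrightarrow> m i > 0" and k: "k \<le> n" "n - k \<le> k"
begin

lemma shifted_egf_pos: "shifted_egf m $ s > 0"
  using m_pos by (simp add: shifted_egf_def)

lemma tilt_shifted_egf_pos: "v > 0 \<Longrightarrow> (tilt (shifted_egf m) T v ^ k) $ (n - k) > 0"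
  using k by (intro fps_power_nth_pos) (auto simp: tilt_nth shifted_egf_pos less_imp_le)

lemma assemblies_k_nonempty: "assemblies_k m n k \<noteq> {}"
  using sum_assemblies_k_tilt[OF k(1), of 1 "{}" m] tilt_shifted_egf_pos[of 1 "{}"] by auto

lemma set_random_assembly: "set_pmf (random_assembly m n k) = assemblies_k m n k"
  unfolding random_assembly_def by (intro set_pmf_of_set finite_assemblies_k assemblies_k_nonempty)

lemma prob_random_assembly:
  "measure_pmf.prob (random_assembly m n k) E
    = card (assemblies_k m n k \<inter> E) / (fact n / fact k * (shifted_egf m ^ k) $ (n - k))"
  unfolding random_assembly_def
  using sum_assemblies_k_tilt[OF k(1), of 1 "{}" m]
  by (simp add: measure_pmf_of_set finite_assemblies_k assemblies_k_nonempty)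

text \<open>The exponential Markov inequality: on \<open>E\<close> the variable
  \<open>v ^ excess_count T a / w\<close> is at least 1, and its mean is a ratio of
  coefficients.\<close>

lemma prob_random_assembly_le:
  assumes "0 \<le> v" "w > 0" "\<And>a. a \<in> assemblies_k m n k \<Longrightarrow> a \<in> E \<Longrightarrow> w \<le> v ^ excess_count T a"
  shows "measure_pmf.prob (random_assembly m n k) E
    \<le> (tilt (shifted_egf m) T v ^ k) $ (n - k) / (w * (shifted_egf m ^ k) $ (n - k))"
proof -
  let ?S = "assemblies_k m n k"
  have pos: "(shifted_egf m ^ k) $ (n - k) > 0" using tilt_shifted_egf_pos[of 1 "{}"] by simp
  have "w * card (?S \<inter> E) = (\<Sum>a\<in>?S \<inter> E. w)" by simp
  also have "\<dots> \<le> (\<Sum>a\<in>?S \<inter> E. v ^ excess_count T a)"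
    using assms by (intro sum_mono) auto
  also have "\<dots> \<le> (\<Sum>a\<in>?S. v ^ excess_count T a)"
    using assms finite_assemblies_k by (intro sum_mono2) auto
  also have "\<dots> = fact n / fact k * (tilt (shifted_egf m) T v ^ k) $ (n - k)"
    by (rule sum_assemblies_k_tilt[OF k(1)])
  finally have "w * card (?S \<inter> E) \<le> fact n / fact k * (tilt (shifted_egf m) T v ^ k) $ (n - k)" .
  then show ?thesis using pos \<open>w > 0\<close> unfolding prob_random_assembly
    by (simp add: field_simps)
qed

text \<open>At \<open>v = 0\<close> the weight \<open>0 ^ excess_count {j..} a\<close> is the
  indicator of a zero count, as \<open>0 ^ 0 = 1\<close>.\<close>

lemma prob_largest_component_le:
  assumes "n \<ge> 1"
  shows "measure_pmf.prob (random_assembly m n k) {a. largest_component a \<le> j}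
    = (tilt (shifted_egf m) {j..} 0 ^ k) $ (n - k) / (shifted_egf m ^ k) $ (n - k)"
proof -
  let ?S = "assemblies_k m n k"
  have "fact n / fact k * (tilt (shifted_egf m) {j..} 0 ^ k) $ (n - k)
    = (\<Sum>a\<in>?S. 0 ^ excess_count {j..} a)"
    by (rule sum_assemblies_k_tilt[OF k(1), symmetric])
  also have "\<dots> = (\<Sum>a\<in>?S \<inter> {a. largest_component a \<le> j}. 1)"
    using finite_assemblies_k largest_component_le_iff[OF _ assms]
    by (intro sum.mono_neutral_cong_right) (auto simp: zero_power)
  also have "\<dots> = card (?S \<inter> {a. largest_component a \<le> j})" by simp
  finally show ?thesis unfolding prob_random_assembly
    by (metis (no_types, lifting) divide_eq_0_iff fact_nonzero mult_divide_mult_cancel_left)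
qed

end

section \<open>Asymptotic growth under tilting\<close>

lemma sum_geometric_le:
  fixes x :: real
  assumes "0 \<le> x" "x \<le> 1/2"
  shows "(\<Sum>j=s..r. x ^ j) \<le> 2 * x ^ s"
proof (cases "s \<le> r")
  case True
  have eq: "(\<Sum>j=s..r. x ^ j) = x ^ s * (\<Sum>j=0..r - s. x ^ j)"
    unfolding sum_distrib_left
    by (rule sum.reindex_bij_witness[where i = "\<lambda>j. j + s" and j = "\<lambda>j. j - s"])
       (use True in \<open>auto simp: power_add[symmetric]\<close>)
  have "(\<Sum>j=0..r - s. x ^ j) \<le> (\<Sum>j=0..r - s. (1/2) ^ j)"
    using assms by (intro sum_mono power_mono) auto
  also have "\<dots> \<le> 2"
    by (subst atLeast0AtMost, subst sum_gp0) (simp add: field_simps)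
  finally have "x ^ s * (\<Sum>j=0..r - s. x ^ j) \<le> x ^ s * 2"
    using assms by (intro mult_left_mono) auto
  with eq show ?thesis by simp
qed (use assms in auto)

text \<open>The analytic setting without assemblies: the geometric bound on the coefficients stands
  for a positive radius of convergence.\<close>

locale tilted_sequence =
  fixes A :: "real fps" and k r :: "nat \<Rightarrow> nat"
  assumes A_pos: "\<And>s. A $ s > 0"
    and geometric_bound: "\<exists>K>0. \<exists>\<beta>>0. \<forall>s. A $ s \<le> K * \<beta> ^ s"
    and ratio: "(\<lambda>n. real (r n) / real (k n)) \<longlonglongrightarrow> 0"
    and k_at_top: "filterlim k at_top sequentially"
begin

lemma k_pos: "eventually (\<lambda>n. k n > 0) sequentially"
  by (rule eventually_compose_filterlim[OF eventually_gt_at_top k_at_top])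

text \<open>The approximate mean number of components of excess \<open>s\<close>:
  \<open>k a_s x^s / a_0\<close>, where \<open>x = a_0 r / (a_1 k)\<close> solves the saddle point
  equation to first order.\<close>

definition \<mu> :: "nat \<Rightarrow> nat \<Rightarrow> real" where
  "\<mu> s n = real (k n) * A $ s / A $ 0 * (A $ 0 * real (r n) / (A $ 1 * real (k n))) ^ s"

definition g :: "nat \<Rightarrow> real" where
  "g n = real (k n) / (real (k n) - real (r n) + 1)"

text \<open>Chosen to meet the hypothesis of \<open>fps_power_nth_shift_le\<close> with equality;
  \<open>g\<close> is the factor by which it differs from \<open>a_0 r / (a_1 k)\<close>.\<close>

definition q :: "nat \<Rightarrow> real" where
  "q n = A $ 0 * real (r n) / (A $ 1 * (real (k n) - real (r n) + 1))"

lemma A_nonneg: "A $ s \<ge> 0" using A_pos[of s] by simp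

lemma mu_nonneg: "\<mu> s n \<ge> 0"
  using A_nonneg unfolding \<mu>_def by (intro mult_nonneg_nonneg divide_nonneg_nonneg zero_le_power) auto

lemma r_le_k: "eventually (\<lambda>n. 2 * r n \<le> k n) sequentially"
proof -
  have "eventually (\<lambda>n. real (r n) / real (k n) < 1/2) sequentially"
    using order_tendstoD(2)[OF ratio, of "1/2"] by simp
  then show ?thesis using k_pos
  proof eventually_elim
    case (elim n)
    then have "2 * real (r n) < real (k n)" by (simp add: field_simps)
    then show ?case by linarith
  qed
qed

lemma q_eq: "eventually (\<lambda>n. q n = A $ 0 / A $ 1 * (real (r n) / real (k n)) * g n) sequentially"
  using k_pos by eventually_elim (simp add: q_def g_def)

lemma q_mult: "eventually (\<lambda>n. q n * A $ 1 * (real (k n) - real (r n) + 1) = A $ 0 * real (r n)) sequentially"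
  using r_le_k
proof eventually_elim
  case (elim n)
  then have "real (k n) - real (r n) + 1 > 0" by linarith
  then show ?case using A_pos[of 1] by (simp add: q_def)
qed

lemma q_nonneg: "eventually (\<lambda>n. q n \<ge> 0) sequentially"
  using r_le_k
proof eventually_elim
  case (elim n)
  then show ?case using A_nonneg[of 0] A_nonneg[of 1] by (simp add: q_def)
qed

lemma g_tendsto: "g \<longlonglongrightarrow> 1"
proof -
  have "(\<lambda>n. 1 / (1 - real (r n) / real (k n) + 1 / real (k n))) \<longlonglongrightarrow> 1 / (1 - 0 + 0)"
    by (intro tendsto_intros ratio tendsto_divide_0[OF tendsto_const]
      filterlim_at_top_imp_at_infinity filterlim_compose[OF filterlim_real_sequentially k_at_top]) auto
  moreover have "eventually (\<lambda>n. 1 / (1 - real (r n) / real (k n) + 1 / real (k n)) = g n) sequentially"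
    using k_pos
  proof eventually_elim
    case (elim n)
    then have "1 - real (r n) / real (k n) + 1 / real (k n) = (real (k n) - real (r n) + 1) / real (k n)"
      by (simp add: field_simps)
    then show ?case by (simp add: g_def)
  qed
  ultimately show ?thesis by (simp add: tendsto_cong)
qed

lemma q_tendsto: "q \<longlonglongrightarrow> 0"
proof -
  have "(\<lambda>n. A $ 0 / A $ 1 * (real (r n) / real (k n)) * g n) \<longlonglongrightarrow> A $ 0 / A $ 1 * 0 * 1"
    by (intro tendsto_intros ratio g_tendsto)
  then show ?thesis using q_eq by (simp add: tendsto_cong)
qed

lemma q_small:
  assumes "\<beta> > 0" "\<epsilon> > 0"
  shows "eventually (\<lambda>n. \<beta> * q n \<le> \<epsilon>) sequentially"
proof -
  have "eventually (\<lambda>n. q n < \<epsilon> / \<beta>) sequentially"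
    using order_tendstoD(2)[OF q_tendsto] assms by simp
  then show ?thesis by eventually_elim (use assms in \<open>simp add: field_simps\<close>)
qed

lemma mu_g: "eventually (\<lambda>n. A $ 0 * (\<mu> s n * g n ^ s) = real (k n) * (A $ s * q n ^ s)) sequentially"
  using q_eq
proof eventually_elim
  case (elim n)
  have "A $ 0 \<noteq> 0" using A_pos[of 0] by simp
  then show ?case unfolding elim \<mu>_def by (simp add: power_mult_distrib power_divide)
qed

text \<open>Index \<open>s\<close> contributes the main term \<open>\<mu> s n * g n ^ s\<close>, and
  all later indices together a geometric tail smaller by a factor of order \<open>q\<close>. The
  function \<open>e\<close> depends on \<open>s\<close> alone, so the bound is uniform in
  \<open>T\<close>, \<open>u\<close> and \<open>v\<close>.\<close>

lemma tilted_growth_le: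
  assumes s: "s \<ge> 1"
  obtains e where "e \<longlonglongrightarrow> 1"
    "eventually (\<lambda>n. \<forall>T u v. T \<subseteq> {s..} \<longrightarrow> u \<le> v \<longrightarrow> u \<ge> 1 \<or> u \<ge> 0 \<and> 1 \<notin> T \<longrightarrow>
      (tilt A T v ^ k n) $ r n \<le> (tilt A T u ^ k n) $ r n * exp (\<mu> s n * e n * (v - u))) sequentially"
proof -
  from geometric_bound obtain K \<beta> :: real
    where K_pos: "K > 0" and beta_pos: "\<beta> > 0" and A_bound: "\<And>s. A $ s \<le> K * \<beta> ^ s" by blast
  \<comment> \<open>Makes \<open>2 K (\<beta> q)^(s+1)\<close>, the bound for the tail, equal to
    \<open>A $ s * q^s * (C q)\<close>.\<close>
  define C where "C = 2 * K * \<beta> ^ Suc s / A $ s"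
  define e where "e n = g n ^ s * (1 + C * q n)" for n
  have "e \<longlonglongrightarrow> 1 ^ s * (1 + C * 0)"
    unfolding e_def by (intro tendsto_intros g_tendsto q_tendsto)
  moreover have "eventually (\<lambda>n. \<forall>T u v. T \<subseteq> {s..} \<longrightarrow> u \<le> v \<longrightarrow> u \<ge> 1 \<or> u \<ge> 0 \<and> 1 \<notin> T \<longrightarrow>
      (tilt A T v ^ k n) $ r n \<le> (tilt A T u ^ k n) $ r n * exp (\<mu> s n * e n * (v - u))) sequentially"
    using r_le_k q_mult q_nonneg k_pos q_small[OF beta_pos, of "1/2", simplified] mu_g[of s]
  proof eventually_elim
    case (elim n)
    show ?case
    proof (intro allI impI)
      fix T :: "nat set" and u v :: real assume T: "T \<subseteq> {s..}" and uv: "u \<le> v" "u \<ge> 1 \<or> u \<ge> 0 \<and> 1 \<notin> T"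
      have "(\<Sum>j=0..r n. if j \<in> T then A $ j * q n ^ j else 0)
          = (\<Sum>j\<in>{0..r n} \<inter> T. A $ j * q n ^ j)"
        by (simp add: sum.inter_restrict)
      \<comment> \<open>Enlarging \<open>T\<close> to all indices from \<open>s\<close> on removes
        the dependence on \<open>T\<close>.\<close>
      also have "\<dots> \<le> (\<Sum>j\<in>insert s {Suc s..r n}. A $ j * q n ^ j)"
        using T elim A_nonneg by (intro sum_mono2) (auto intro!: mult_nonneg_nonneg)
      also have "\<dots> = A $ s * q n ^ s + (\<Sum>j\<in>{Suc s..r n}. A $ j * q n ^ j)"
        by (subst sum.insert) auto
      also have "(\<Sum>j\<in>{Suc s..r n}. A $ j * q n ^ j) \<le> (\<Sum>j\<in>{Suc s..r n}. K * (\<beta> * q n) ^ j)"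
        using elim by (intro sum_mono) (auto simp: power_mult_distrib mult.assoc[symmetric] intro!: mult_right_mono A_bound)
      also have "\<dots> = K * (\<Sum>j\<in>{Suc s..r n}. (\<beta> * q n) ^ j)" by (simp add: sum_distrib_left)
      also have "\<dots> \<le> K * (2 * (\<beta> * q n) ^ Suc s)"
        using elim K_pos beta_pos by (intro mult_left_mono sum_geometric_le) auto
      also have "A $ s * q n ^ s + K * (2 * (\<beta> * q n) ^ Suc s) = A $ s * q n ^ s * (1 + C * q n)"
        using A_pos[of s] by (simp add: C_def power_mult_distrib field_simps)
      finally have "real (k n) * (\<Sum>j=0..r n. if j \<in> T then A $ j * q n ^ j else 0)
          \<le> real (k n) * (A $ s * q n ^ s * (1 + C * q n))"
        by (intro mult_left_mono) auto
      also have "\<dots> = real (k n) * (A $ s * q n ^ s) * (1 + C * q n)" by simp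
      also have "\<dots> = A $ 0 * (\<mu> s n * e n)" unfolding e_def elim(6)[symmetric] by simp
      finally have U: "real (k n) * (\<Sum>j=0..r n. if j \<in> T then A $ j * q n ^ j else 0)
          \<le> A $ 0 * (\<mu> s n * e n)" .
      have "0 \<notin> T" using T s by auto
      then show "(tilt A T v ^ k n) $ r n \<le> (tilt A T u ^ k n) $ r n * exp (\<mu> s n * e n * (v - u))"
        using elim(1-4) uv U A_nonneg A_pos
        by (intro tilt_power_growth_le[where q = "q n"]) auto
    qed
  qed
  ultimately show thesis using that by simp
qed

text \<open>Here \<open>r h\<close> plays the role of \<open>d\<close>, and the error factor is
  \<open>h ^ s\<close>. It tends to 1 since \<open>s / r\<close> vanishes for \<open>r\<close>
  tending to infinity and \<open>q\<close> tends to 0.\<close>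

lemma tilted_growth_ge:
  assumes s: "s \<ge> 1" and r: "filterlim r at_top sequentially"
  obtains e where "e \<longlonglongrightarrow> 1"
    "eventually (\<lambda>n. \<forall>T u v. s \<in> T \<longrightarrow> 0 \<notin> T \<longrightarrow> 0 \<le> u \<longrightarrow> u \<le> v \<longrightarrow> v \<le> 1 \<longrightarrow> 1/2 \<le> u \<or> 1 \<notin> T \<longrightarrow>
      (tilt A T u ^ k n) $ r n \<le> (tilt A T v ^ k n) $ r n * exp (- (\<mu> s n * e n * (v - u)))) sequentially"
proof -
  from geometric_bound obtain K \<beta> :: real
    where K_pos: "K > 0" and beta_pos: "\<beta> > 0" and A_bound: "\<And>s. A $ s \<le> K * \<beta> ^ s" by blast
  \<comment> \<open>Chosen so that \<open>k E = r (C g q)\<close> for the \<open>E\<close> defined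
    below.\<close>
  define C where "C = 32 * K * \<beta>\<^sup>2 / A $ 1"
  define h where "h n = 1 - real s / real (r n) - C * g n * q n" for n
  have "h \<longlonglongrightarrow> 1 - 0 - C * 1 * 0"
    unfolding h_def by (intro tendsto_intros g_tendsto q_tendsto tendsto_divide_0[OF tendsto_const]
      filterlim_at_top_imp_at_infinity filterlim_compose[OF filterlim_real_sequentially r])
  then have h: "h \<longlonglongrightarrow> 1" by simp
  have h_pos: "eventually (\<lambda>n. h n > 0) sequentially" using order_tendstoD(1)[OF h, of 0] by simp
  have r_ge: "eventually (\<lambda>n. r n \<ge> s + 1) sequentially" using r unfolding filterlim_at_top by blast
  have "(\<lambda>n. h n ^ s) \<longlonglongrightarrow> 1 ^ s" by (intro tendsto_intros h)
  moreover have "eventually (\<lambda>n. \<forall>T u v. s \<in> T \<longrightarrow> 0 \<notin> T \<longrightarrow> 0 \<le> u \<longrightarrow> u \<le> v \<longrightarrow> v \<le> 1 \<longrightarrow> 1/2 \<le> u \<or> 1 \<notin> T \<longrightarrow>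
      (tilt A T u ^ k n) $ r n \<le> (tilt A T v ^ k n) $ r n * exp (- (\<mu> s n * h n ^ s * (v - u)))) sequentially"
    using r_le_k q_mult q_nonneg k_pos q_small[OF beta_pos, of "1/8", simplified] h_pos r_ge q_eq
  proof eventually_elim
    case (elim n)
    \<comment> \<open>The lower bound uses \<open>2 q\<close> in place of \<open>q\<close>. With
      \<open>j \<le> 2^j\<close> the error sum is at most \<open>K\<close> times a geometric sum in
      \<open>4 \<beta> q \<le> 1/2\<close>, hence at most
      \<open>2 K (4 \<beta> q)^2\<close>.\<close>
    define E where "E = 32 * K * \<beta>\<^sup>2 * (q n)\<^sup>2 / A $ 0"
    have pos: "A $ 0 > 0" "A $ 1 > 0" "A $ s > 0" "real (k n) > 0" "real (r n) > 0"
      using A_pos elim by auto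
    show ?case
    proof (intro allI impI)
      fix T :: "nat set" and u v :: real assume T: "s \<in> T" "0 \<notin> T" and uv: "0 \<le> u" "u \<le> v" "v \<le> 1" "1/2 \<le> u \<or> 1 \<notin> T"
      have "(\<Sum>j=2..r n. real j * A $ j * (2 * q n) ^ j) \<le> (\<Sum>j=2..r n. K * (4 * (\<beta> * q n)) ^ j)"
      proof (rule sum_mono)
        fix j
        have "real j * A $ j * (2 * q n) ^ j \<le> 2 ^ j * (K * \<beta> ^ j) * (2 * q n) ^ j"
          using elim A_nonneg less_exp[of j]
          by (intro mult_right_mono mult_mono A_bound) (auto simp: of_nat_less_two_power less_imp_le)
        also have "\<dots> = K * (2 * \<beta> * (2 * q n)) ^ j" by (simp only: power_mult_distrib mult_ac)
        also have "2 * \<beta> * (2 * q n) = 4 * (\<beta> * q n)" by simp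
        finally show "real j * A $ j * (2 * q n) ^ j \<le> K * (4 * (\<beta> * q n)) ^ j" .
      qed
      also have "\<dots> = K * (\<Sum>j=2..r n. (4 * (\<beta> * q n)) ^ j)" by (simp add: sum_distrib_left)
      also have "\<dots> \<le> K * (2 * (4 * (\<beta> * q n))\<^sup>2)"
        using elim(3,5) K_pos beta_pos by (intro mult_left_mono sum_geometric_le) auto
      also have "\<dots> = A $ 0 * E" using pos by (simp add: E_def power_mult_distrib)
      finally have E: "(\<Sum>j=2..r n. real j * A $ j * (2 * q n) ^ j) \<le> A $ 0 * E" .
      have E0: "E \<ge> 0" unfolding E_def using pos K_pos by simp
      have kE: "real (k n) * E = real (r n) * (C * g n * q n)"
      proof -
        have "real (k n) * E = 32 * K * \<beta>\<^sup>2 * q n / A $ 0 * (real (k n) * q n)"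
          by (simp add: E_def power2_eq_square)
        also have "real (k n) * q n = A $ 0 / A $ 1 * real (r n) * g n"
          using pos elim(8) by simp
        also have "32 * K * \<beta>\<^sup>2 * q n / A $ 0 * (A $ 0 / A $ 1 * real (r n) * g n)
            = real (r n) * (C * g n * q n)"
          using pos by (simp add: C_def)
        finally show ?thesis .
      qed
      have d: "real (r n) * h n \<le> real (r n) - real s - real (k n) * E"
        unfolding kE h_def using pos by (simp add: field_simps)
      have L: "\<mu> s n * h n ^ s \<le> real (k n) * A $ s * (A $ 0) ^ (s - 1) *
          (real (r n) * h n / (real (k n) * A $ 1)) ^ s"
      proof -
        obtain s' where s': "s = Suc s'" using s by (cases s) auto
        define X where "X = real (r n) / (real (k n) * A $ 1)"
        have X: "A $ 0 * real (r n) / (A $ 1 * real (k n)) = A $ 0 * X"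
          "real (r n) * h n / (real (k n) * A $ 1) = X * h n" by (simp_all add: X_def)
        show ?thesis unfolding \<mu>_def s' X
          using pos by (simp add: power_mult_distrib)
      qed
      have "(tilt A T u ^ k n) $ r n \<le> (tilt A T v ^ k n) $ r n * exp (- (\<mu> s n * h n ^ s) * (v - u))"
        by (rule tilt_power_growth_ge[where q = "2 * q n", OF A_nonneg A_pos A_pos _ _ T(1) _ _ elim(4) T(2) uv E E0 _ d L])
          (use elim pos in auto)
      then show "(tilt A T u ^ k n) $ r n \<le> (tilt A T v ^ k n) $ r n * exp (- (\<mu> s n * h n ^ s * (v - u)))"
        by simp
    qed
  qed
  ultimately show thesis using that by simp
qed

end

section \<open>The saddle point equation\<close>

context
  fixes m :: "nat \<Rightarrow> nat"
  assumes m_pos: "\<And>i. i \<ge> 1 \<Longrightarrow> m i > 0" and radius: "fps_conv_radius (assembly_egf m) > 0"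
begin

lemma egf_nonneg: "assembly_egf m $ i \<ge> 0"
  by (simp add: assembly_egf_def)

lemma egf_summable_point: obtains x0 where "x0 > 0" "ereal x0 < fps_conv_radius (assembly_egf m)"
  using ereal_dense2[of 0 "fps_conv_radius (assembly_egf m)"] radius by (auto simp: zero_ereal_def)

text \<open>The terms of the series at a point \<open>x0\<close> inside the disc of convergence are
  bounded, so \<open>\<beta> = 1 / x0\<close> works.\<close>

lemma shifted_egf_geometric_bound: "\<exists>K>0. \<exists>\<beta>>0. \<forall>s. shifted_egf m $ s \<le> K * \<beta> ^ s"
proof -
  obtain x0 where x0: "x0 > 0" "ereal x0 < fps_conv_radius (assembly_egf m)" by (rule egf_summable_point)
  then have "summable (\<lambda>i. assembly_egf m $ i * x0 ^ i)" by (intro summable_fps) simp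
  then have "Bseq (\<lambda>i. assembly_egf m $ i * x0 ^ i)"
    using summable_LIMSEQ_zero convergent_def convergent_imp_Bseq by blast
  then obtain K where K: "K > 0" "\<And>i. norm (assembly_egf m $ i * x0 ^ i) \<le> K" by (auto simp: Bseq_def)
  have "shifted_egf m $ s \<le> (K / x0) * (1 / x0) ^ s" for s
  proof -
    have "shifted_egf m $ s = assembly_egf m $ Suc s" by (simp add: shifted_egf_def assembly_egf_def)
    also have "assembly_egf m $ Suc s * x0 ^ Suc s \<le> K" using K(2)[of "Suc s"] by (simp add: abs_le_iff)
    then have "assembly_egf m $ Suc s \<le> K / x0 ^ Suc s" using x0 by (subst pos_le_divide_eq) auto
    finally show ?thesis by (simp add: power_divide)
  qed
  then show ?thesis using K x0 by (intro exI[of _ "K / x0"] exI[of _ "1 / x0"] conjI) auto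
qed

text \<open>With \<open>a0 = m_1\<close> and \<open>a1 = m_2 / 2\<close>, the equation reads
  \<open>a1 x^2 = c M(x)\<close>, where \<open>M(x)\<close> lies between \<open>a0 x\<close> and
  \<open>a0 x + B x^2\<close> for small \<open>x\<close>. The lower estimate keeps all solutions
  above \<open>\<rho> c\<close>; the upper one gives a sign change before
  \<open>2 \<rho> c\<close>.\<close>

lemma smallest_pos_solution_asymp:
  defines "\<rho> \<equiv> shifted_egf m $ 0 / shifted_egf m $ 1"
  obtains c0 C where "c0 > 0"
    "\<And>c. 0 < c \<Longrightarrow> c < c0 \<Longrightarrow> \<exists>x. smallest_pos_solution m c x"
    "\<And>c x. 0 < c \<Longrightarrow> c < c0 \<Longrightarrow> smallest_pos_solution m c x \<Longrightarrow> \<rho> * c \<le> x \<and> x \<le> \<rho> * c * (1 + C * c)"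
proof -
  define a0 where "a0 = real (m 1)"
  define a1 where "a1 = real (m 2) / 2"
  have a: "a0 > 0" "a1 > 0" using m_pos by (auto simp: a0_def a1_def)
  have \<rho>: "\<rho> = a0 / a1" unfolding \<rho>_def by (simp add: shifted_egf_def a0_def a1_def numeral_2_eq_2)
  have egf_01: "assembly_egf m $ 0 = 0" "assembly_egf m $ 1 = a0" by (simp_all add: assembly_egf_def a0_def)
  obtain x0 where x0: "x0 > 0" "ereal x0 < fps_conv_radius (assembly_egf m)" by (rule egf_summable_point)
  define B where "B = (\<Sum>i. assembly_egf m $ (i + 2) * x0 ^ i)"
  have summable: "summable (\<lambda>i. assembly_egf m $ i * x ^ i)" if "0 \<le> x" "x \<le> x0" for x
  proof (rule summable_fps)
    have "ereal (norm x) \<le> ereal x0" using that by simp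
    then show "ereal (norm x) < fps_conv_radius (assembly_egf m)" using x0(2) by (rule le_less_trans)
  qed
  have summable2: "summable (\<lambda>i. assembly_egf m $ (i + 2) * x ^ i)" if "0 < x" "x \<le> x0" for x
  proof -
    have "summable (\<lambda>i. assembly_egf m $ (i + 2) * x ^ (i + 2) / x\<^sup>2)"
      using summable[of x] that by (intro summable_divide) (subst summable_iff_shift, simp)
    also have "(\<lambda>i. assembly_egf m $ (i + 2) * x ^ (i + 2) / x\<^sup>2) = (\<lambda>i. assembly_egf m $ (i + 2) * x ^ i)"
      using that by (simp add: power2_eq_square)
    finally show ?thesis .
  qed
  have B: "B \<ge> 0" unfolding B_def using x0 egf_nonneg by (intro suminf_nonneg summable2) auto
  have M_ge: "a0 * x \<le> eval_fps (assembly_egf m) x" if "x > 0" "summable (\<lambda>i. assembly_egf m $ i * x ^ i)" for x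
  proof -
    have "(\<Sum>i\<in>{1}. assembly_egf m $ i * x ^ i) \<le> (\<Sum>i. assembly_egf m $ i * x ^ i)"
      using that egf_nonneg by (intro sum_le_suminf) auto
    then show ?thesis using egf_01 by (simp add: eval_fps_def)
  qed
  have M_le: "eval_fps (assembly_egf m) x \<le> a0 * x + B * x\<^sup>2" if "0 < x" "x \<le> x0" for x
  proof -
    have "eval_fps (assembly_egf m) x = (\<Sum>i. assembly_egf m $ (i + 2) * x ^ (i + 2)) + (\<Sum>i<2. assembly_egf m $ i * x ^ i)"
      unfolding eval_fps_def using summable[of x] that by (intro suminf_split_initial_segment) auto
    also have "(\<Sum>i. assembly_egf m $ (i + 2) * x ^ (i + 2)) = (\<Sum>i. assembly_egf m $ (i + 2) * x ^ i * x\<^sup>2)"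
      by (simp add: power2_eq_square mult_ac)
    also have "\<dots> = (\<Sum>i. assembly_egf m $ (i + 2) * x ^ i) * x\<^sup>2"
      by (rule suminf_mult2[symmetric, OF summable2[OF that]])
    also have "(\<Sum>i<2. assembly_egf m $ i * x ^ i) = a0 * x" using egf_01 by (simp add: numeral_2_eq_2)
    also have "(\<Sum>i. assembly_egf m $ (i + 2) * x ^ i) \<le> B" unfolding B_def
      using that x0 egf_nonneg by (intro suminf_le summable2 mult_left_mono power_mono) auto
    finally show ?thesis by (simp add: mult_right_mono)
  qed
  have sol: "pos_solution m c x \<longleftrightarrow> x > 0 \<and> summable (\<lambda>i. assembly_egf m $ i * x ^ i) \<and> a1 * x\<^sup>2 = c * eval_fps (assembly_egf m) x" for c x
  proof (cases "x > 0 \<and> summable (\<lambda>i. assembly_egf m $ i * x ^ i)")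
    case True
    then have "eval_fps (assembly_egf m) x > 0" using M_ge[of x] a by (auto intro: less_le_trans[of 0 "a0 * x"])
    then show ?thesis using True by (auto simp: pos_solution_def a1_def field_simps)
  qed (auto simp: pos_solution_def)
  have sol_ge: "\<rho> * c \<le> x" if "pos_solution m c x" "c > 0" for c x
  proof -
    have x: "x > 0" using that sol by auto
    have "c * (a0 * x) \<le> c * eval_fps (assembly_egf m) x" using that M_ge[of x] sol by (intro mult_left_mono) auto
    also have "\<dots> = a1 * x\<^sup>2" using that sol by auto
    finally have "(c * a0) * x \<le> (a1 * x) * x" by (simp add: power2_eq_square mult_ac)
    then have "c * a0 \<le> a1 * x" using x by simp
    then show ?thesis using a by (simp add: \<rho> field_simps)
  qed
  \<comment> \<open>The first bound keeps \<open>2 \<rho> c\<close> within \<open>x0\<close>; the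
    second gives \<open>B * (2 \<rho> c) \<le> a0\<close>, which yields the sign at
    \<open>2 \<rho> c\<close>. Using \<open>B + 1\<close> avoids a zero denominator.\<close>
  define c0 where "c0 = min (x0 / (2 * \<rho>)) (a1 / (2 * (B + 1)))"
  have \<rho>_pos: "\<rho> > 0" using a by (simp add: \<rho>)
  have c0: "c0 > 0" using x0 a \<rho>_pos B by (simp add: c0_def)
  have bounds: "2 * \<rho> * c \<le> x0" "B * (2 * \<rho> * c) \<le> a0" if "0 < c" "c < c0" for c
  proof -
    show "2 * \<rho> * c \<le> x0" using that \<rho>_pos by (simp add: c0_def field_simps)
    have "B * (2 * \<rho> * c) \<le> (B + 1) * (2 * \<rho> * c)" using that \<rho>_pos by (intro mult_right_mono) auto
    also have "c * (2 * (B + 1)) \<le> a1" using that B by (simp add: c0_def pos_less_divide_eq)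
    then have "\<rho> * (c * (2 * (B + 1))) \<le> \<rho> * a1" using \<rho>_pos by (intro mult_left_mono) auto
    then have "(B + 1) * (2 * \<rho> * c) \<le> a0" using a by (simp add: \<rho> mult_ac)
    finally show "B * (2 * \<rho> * c) \<le> a0" .
  qed
  have ex: "\<exists>x. smallest_pos_solution m c x \<and> x \<le> 2 * \<rho> * c" if c: "0 < c" "c < c0" for c
  proof -
    let ?f = "\<lambda>x. a1 * x\<^sup>2 - c * eval_fps (assembly_egf m) x"
    let ?I = "{\<rho> * c..2 * \<rho> * c}"
    have I: "x > 0 \<and> x \<le> x0" if "x \<in> ?I" for x
      using that bounds(1)[OF c] mult_pos_pos[OF \<rho>_pos c(1)] by simp
    have cont: "continuous_on ?I ?f"
    proof (intro continuous_intros)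
      show "(\<lambda>x. x) ` ?I \<subseteq> eball 0 (fps_conv_radius (assembly_egf m))"
      proof safe
        fix x assume "x \<in> ?I"
        then have "ereal \<bar>x\<bar> \<le> ereal x0" using I[of x] by simp
        also note x0(2)
        finally show "x \<in> eball 0 (fps_conv_radius (assembly_egf m))" by (simp add: in_eball_iff)
      qed
    qed
    have le: "\<rho> * c \<le> 2 * \<rho> * c" using \<rho>_pos c by simp
    have "?f (\<rho> * c) \<le> 0"
    proof -
      have "c * (a0 * (\<rho> * c)) \<le> c * eval_fps (assembly_egf m) (\<rho> * c)"
        using I[of "\<rho> * c"] le c summable by (intro mult_left_mono M_ge) auto
      moreover have "c * (a0 * (\<rho> * c)) = a1 * (\<rho> * c)\<^sup>2"
        using a by (simp add: \<rho> power2_eq_square)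
      ultimately show ?thesis by simp
    qed
    moreover have "0 \<le> ?f (2 * \<rho> * c)"
    proof -
      let ?y = "2 * \<rho> * c"
      have y: "?y > 0" "?y \<le> x0" using I[of ?y] le by auto
      have "c * eval_fps (assembly_egf m) ?y \<le> c * (a0 * ?y + B * ?y\<^sup>2)" using c M_le[OF y] by (intro mult_left_mono) auto
      also have "\<dots> = c * ?y * (a0 + B * ?y)" by (simp add: power2_eq_square algebra_simps)
      also have "\<dots> \<le> c * ?y * (a0 + a0)" using bounds(2)[OF c] c y by (intro mult_left_mono) auto
      also have "\<dots> = a1 * ?y\<^sup>2" using a by (simp add: \<rho> power2_eq_square)
      finally show ?thesis by simp
    qed
    ultimately obtain z where z: "z \<in> ?I" "?f z = 0"
      using IVT'[of ?f "\<rho> * c" 0 "2 * \<rho> * c"] le cont by auto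
    \<comment> \<open>The zeros in the interval form a nonempty compact set, so there is a least
      one. No solution lies below \<open>\<rho> c\<close>, hence it is the smallest of all.\<close>
    let ?Z = "{x \<in> ?I. ?f x = 0}"
    have "compact ?Z"
      unfolding compact_eq_bounded_closed
      by (intro conjI continuous_closed_preimage_constant cont bounded_subset[of ?I ?Z]) auto
    moreover have "?Z \<noteq> {}" using z by blast
    ultimately obtain x where x: "x \<in> ?Z" "\<And>y. y \<in> ?Z \<Longrightarrow> x \<le> y"
      using continuous_attains_inf[of ?Z "\<lambda>x. x"] by auto
    have xpos: "pos_solution m c x" using x(1) I[of x] summable[of x] sol by auto
    have "x \<le> y" if y: "pos_solution m c y" for y
    proof (cases "y \<le> 2 * \<rho> * c")
      case True
      then show ?thesis using sol_ge[OF y c(1)] y sol x(2)[of y] by auto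
    qed (use x(1) in auto)
    then show ?thesis using xpos x(1) by (auto simp: smallest_pos_solution_def)
  qed
  show thesis
  proof (rule that[OF c0])
    show "\<exists>x. smallest_pos_solution m c x" if "0 < c" "c < c0" for c
      using ex[OF that] by blast
    fix c x assume c: "0 < c" "c < c0" and x: "smallest_pos_solution m c x"
    obtain x' where x': "smallest_pos_solution m c x'" "x' \<le> 2 * \<rho> * c" using ex[OF c] by blast
    have xs: "pos_solution m c x" using x by (simp add: smallest_pos_solution_def)
    have "x \<le> x'" using x x'(1) by (simp add: smallest_pos_solution_def)
    then have le: "x \<le> 2 * \<rho> * c" using x'(2) by simp
    have pos: "x > 0" using xs sol by auto
    \<comment> \<open>The crude bound \<open>x \<le> 2 \<rho> c\<close> is fed back into the
      equation and improves itself to a relative error of order \<open>c\<close>.\<close>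
    have "a1 * x\<^sup>2 = c * eval_fps (assembly_egf m) x" using xs sol by auto
    also have "\<dots> \<le> c * (a0 * x + B * x\<^sup>2)"
      using c pos le bounds(1)[OF c] by (intro mult_left_mono M_le) auto
    finally have "(a1 * x) * x \<le> (c * (a0 + B * x)) * x" by (simp add: power2_eq_square algebra_simps)
    then have "a1 * x \<le> c * (a0 + B * x)" using pos by simp
    also have "\<dots> \<le> c * (a0 + B * (2 * \<rho> * c))" using c B le by (intro mult_left_mono add_left_mono) auto
    finally have "x \<le> c * (a0 + B * (2 * \<rho> * c)) / a1" using a by (simp add: pos_le_divide_eq mult.commute)
    also have "\<dots> = \<rho> * c * (1 + 2 * B / a1 * c)" using a by (simp add: \<rho> field_simps)
    finally show "\<rho> * c \<le> x \<and> x \<le> \<rho> * c * (1 + 2 * B / a1 * c)" using sol_ge[OF xs c(1)] by simp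
  qed
qed

end

section \<open>Largest component and component counts\<close>

text \<open>Borel--Cantelli for each tolerance \<open>1 / (j + 1)\<close>, then a countable
  intersection over \<open>j\<close>. The convergence half of Borel--Cantelli sees only the marginal
  laws, so every coupling is covered.\<close>

lemma AE_asymp_equiv_of_summable:
  fixes f :: "assembly \<Rightarrow> nat" and y :: "nat \<Rightarrow> real"
  assumes coupled: "coupled_assemblies m k \<Omega> X"
    and y_pos: "eventually (\<lambda>n. y n > 0) sequentially"
    and tail: "\<And>\<eta>. 0 < \<eta> \<Longrightarrow> \<eta> \<le> 1 \<Longrightarrow> \<exists>b. summable b \<and> (\<forall>\<^sub>F n in sequentially.
      measure_pmf.prob (random_assembly m n (k n)) {a. \<bar>real (f a) - y n\<bar> > \<eta> * y n} \<le> b n)"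
  shows "AE \<omega> in \<Omega>. (\<lambda>n. real (f (X n \<omega>))) \<sim>[sequentially] y"
proof -
  interpret prob_space \<Omega> using coupled by (simp add: coupled_assemblies_def)
  let ?\<eta> = "\<lambda>j::nat. 1 / (real j + 1)"
  let ?B = "\<lambda>j n. {a. \<bar>real (f a) - y n\<bar> > ?\<eta> j * y n}"
  have "AE \<omega> in \<Omega>. \<forall>j. eventually (\<lambda>n. \<bar>real (f (X n \<omega>)) - y n\<bar> \<le> ?\<eta> j * y n) sequentially"
  proof (subst AE_all_countable, intro allI)
    fix j
    \<comment> \<open>A coupling prescribes nothing about \<open>X 0\<close>, so the event at index
      0 is set to be empty.\<close>
    define E where "E n = (if n = 0 then {} else X n -` ?B j n \<inter> space \<Omega>)" for n
    obtain b where b: "summable b" "eventually (\<lambda>n.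
      measure_pmf.prob (random_assembly m n (k n)) (?B j n) \<le> b n) sequentially"
      using tail[of "?\<eta> j"] by (auto simp: field_simps)
    have X: "X n \<in> measurable \<Omega> (count_space UNIV)" if "n \<ge> 1" for n
      using coupled that by (auto simp: coupled_assemblies_def)
    have E: "E n \<in> sets \<Omega>" for n
      using measurable_sets[OF X[of n], of "?B j n"] by (auto simp: E_def)
    have measure_E: "measure \<Omega> (E n) = measure_pmf.prob (random_assembly m n (k n)) (?B j n)" if "n \<ge> 1" for n
    proof -
      have "measure_pmf.prob (random_assembly m n (k n)) (?B j n)
        = measure (distr \<Omega> (count_space UNIV) (X n)) (?B j n)"
        using coupled that by (auto simp: coupled_assemblies_def)
      also have "\<dots> = measure \<Omega> (E n)"
        using that by (subst measure_distr[OF X[OF that]]) (auto simp: E_def)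
      finally show ?thesis ..
    qed
    have "eventually (\<lambda>n. norm (measure \<Omega> (E n)) \<le> b n) sequentially"
      using b(2) eventually_ge_at_top[of 1] by eventually_elim (simp add: measure_E)
    then have "summable (\<lambda>n. measure \<Omega> (E n))"
      by (rule summable_comparison_test_ev) (fact b(1))
    then have "AE \<omega> in \<Omega>. eventually (\<lambda>n. \<omega> \<in> space \<Omega> - E n) sequentially"
      by (intro borel_cantelli_AE1 E) (auto simp: less_top[symmetric])
    then show "AE \<omega> in \<Omega>. eventually (\<lambda>n. \<bar>real (f (X n \<omega>)) - y n\<bar> \<le> ?\<eta> j * y n) sequentially"
    proof eventually_elim
      case (elim \<omega>)
      then show ?case using eventually_ge_at_top[of 1]
        by eventually_elim (auto simp: E_def not_less)
    qed
  qed
  then show ?thesis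
  proof eventually_elim
    case (elim \<omega>)
    have "(\<lambda>n. real (f (X n \<omega>)) / y n) \<longlonglongrightarrow> 1"
    proof (rule tendstoI)
      fix e :: real assume "e > 0"
      then obtain j where j: "?\<eta> j < e"
        using reals_Archimedean[of e] by (auto simp: field_simps)
      from elim have "eventually (\<lambda>n. \<bar>real (f (X n \<omega>)) - y n\<bar> \<le> ?\<eta> j * y n) sequentially" by blast
      then show "eventually (\<lambda>n. dist (real (f (X n \<omega>)) / y n) 1 < e) sequentially"
        using y_pos
      proof eventually_elim
        case (elim n)
        have "dist (real (f (X n \<omega>)) / y n) 1 = \<bar>real (f (X n \<omega>)) - y n\<bar> / y n"
        proof -
          have "real (f (X n \<omega>)) / y n - 1 = (real (f (X n \<omega>)) - y n) / y n"
            using elim by (simp add: diff_divide_distrib)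
          then show ?thesis using elim by (simp add: dist_real_def abs_divide)
        qed
        also have "\<dots> \<le> ?\<eta> j" using elim by (simp add: pos_divide_le_eq)
        finally show ?case using j by simp
      qed
    qed
    then show ?case by (rule asymp_equivI'[rotated -1])
  qed
qed

locale assembly_sequence =
  fixes m k r :: "nat \<Rightarrow> nat"
  assumes m_pos: "\<And>i. i \<ge> 1 \<Longrightarrow> m i > 0"
    and radius: "fps_conv_radius (assembly_egf m) > 0"
    and k_range: "\<And>n. n \<ge> 1 \<Longrightarrow> 1 \<le> k n \<and> k n \<le> n"
    and r_def: "\<And>n. r n = n - k n"
    and r_small: "(\<lambda>n. real (r n) / real n) \<longlonglongrightarrow> 0"
begin

lemma n_eq: "eventually (\<lambda>n. real n = real (k n) + real (r n)) sequentially"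
  using eventually_ge_at_top[of 1]
proof eventually_elim
  case (elim n)
  then show ?case using k_range[of n] r_def[of n] by simp
qed

lemma k_over_n: "(\<lambda>n. real (k n) / real n) \<longlonglongrightarrow> 1"
proof -
  have "(\<lambda>n. 1 - real (r n) / real n) \<longlonglongrightarrow> 1 - 0" by (intro tendsto_intros r_small)
  moreover have "eventually (\<lambda>n. 1 - real (r n) / real n = real (k n) / real n) sequentially"
    using n_eq eventually_ge_at_top[of 1] by eventually_elim (simp add: field_simps)
  ultimately show ?thesis by (simp add: tendsto_cong)
qed

lemma n_over_k: "(\<lambda>n. real n / real (k n)) \<longlonglongrightarrow> 1"
  using tendsto_inverse[OF k_over_n] by simp

lemma k_at_top: "filterlim k at_top sequentially"
proof -
  have "filterlim (\<lambda>n. real (k n) / real n * real n) at_top sequentially"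
    by (rule filterlim_tendsto_pos_mult_at_top[OF k_over_n _ filterlim_real_sequentially]) simp
  moreover have "eventually (\<lambda>n. real (k n) / real n * real n = real (k n)) sequentially"
    using eventually_ge_at_top[of 1] by eventually_elim simp
  ultimately have "filterlim (\<lambda>n. real (k n)) at_top sequentially"
    by (simp add: filterlim_cong)
  then show ?thesis by (simp add: filterlim_sequentially_iff_filterlim_real)
qed

sublocale tilted_sequence "shifted_egf m" k r
proof
  show "shifted_egf m $ s > 0" for s using m_pos by (simp add: shifted_egf_def)
  show "\<exists>K>0. \<exists>\<beta>>0. \<forall>s. shifted_egf m $ s \<le> K * \<beta> ^ s"
    by (rule shifted_egf_geometric_bound[OF m_pos radius])
  have "(\<lambda>n. real (r n) / real n * (real n / real (k n))) \<longlonglongrightarrow> 0"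
    using tendsto_mult[OF r_small n_over_k] by (simp only: mult_zero_left)
  moreover have "eventually (\<lambda>n. real (r n) / real n * (real n / real (k n)) = real (r n) / real (k n)) sequentially"
    using eventually_ge_at_top[of 1] by eventually_elim simp
  ultimately show "(\<lambda>n. real (r n) / real (k n)) \<longlonglongrightarrow> 0"
    by (rule Lim_transform_eventually)
qed (rule k_at_top)

lemma admissible: "eventually (\<lambda>n. n \<ge> 1 \<and> k n \<le> n \<and> n - k n \<le> k n \<and> n - k n = r n) sequentially"
  using eventually_ge_at_top[of 1] r_le_k
proof eventually_elim
  case (elim n)
  then show ?case using k_range[of n] r_def[of n] by auto
qed

section \<open>Distribution of the largest component and Chernoff bounds for counts\<close>

abbreviation "coef n \<equiv> (shifted_egf m ^ k n) $ r n"
abbreviation "tilted T v n \<equiv> (tilt (shifted_egf m) T v ^ k n) $ r n"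

lemma tilted_pos: "v > 0 \<Longrightarrow> eventually (\<lambda>n. tilted T v n > 0) sequentially"
  using admissible
proof eventually_elim
  case (elim n)
  then show ?case using tilt_shifted_egf_pos[OF m_pos, where k = "k n" and n = n and v = v and T = T] by auto
qed

lemma coef_pos: "eventually (\<lambda>n. coef n > 0) sequentially"
  using tilted_pos[of 1 "{}"] by simp

text \<open>The growth bound from tilt 0 to tilt 1 for \<open>T = {j..}\<close>. With
  \<open>j \<ge> 2\<close> the index 1 is outside \<open>T\<close>, which permits the tilt
  0.\<close>

lemma prob_largest_ge:
  assumes "j \<ge> 2"
  obtains e where "e \<longlonglongrightarrow> 1" "eventually (\<lambda>n. exp (- (\<mu> j n * e n))
    \<le> measure_pmf.prob (random_assembly m n (k n)) {a. largest_component a \<le> j}) sequentially"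
proof -
  obtain e where e: "e \<longlonglongrightarrow> 1"
    "eventually (\<lambda>n. \<forall>T u v. T \<subseteq> {j..} \<longrightarrow> u \<le> v \<longrightarrow> u \<ge> 1 \<or> u \<ge> 0 \<and> 1 \<notin> T \<longrightarrow>
      tilted T v n \<le> tilted T u n * exp (\<mu> j n * e n * (v - u))) sequentially"
    using tilted_growth_le[of j] assms by auto
  have "eventually (\<lambda>n. exp (- (\<mu> j n * e n))
    \<le> measure_pmf.prob (random_assembly m n (k n)) {a. largest_component a \<le> j}) sequentially"
    using e(2) admissible coef_pos
  proof eventually_elim
    case (elim n)
    have "coef n \<le> tilted {j..} 0 n * exp (\<mu> j n * e n)"
      using elim(1)[rule_format, of "{j..}" 0 1] assms by simp
    then have "exp (- (\<mu> j n * e n)) \<le> tilted {j..} 0 n / coef n"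
      using elim(3) by (simp add: exp_minus field_simps)
    then show ?case using prob_largest_component_le[OF m_pos, where k = "k n" and n = n and j = j] elim(2) by auto
  qed
  then show thesis using e(1) that by blast
qed

text \<open>On the event no component has excess in \<open>{j..}\<close>, so
  \<open>u ^ excess_count {j..} a\<close> is 1 there. Tilt \<open>u = 0\<close> gives the sharp
  constant; for \<open>j = 1\<close> the tilt has to stay at or above \<open>1/2\<close>.\<close>

lemma prob_largest_le:
  assumes "j \<ge> 1" "0 \<le> u" "u < 1" "1/2 \<le> u \<or> j \<ge> 2" "filterlim r at_top sequentially"
  obtains e where "e \<longlonglongrightarrow> 1" "eventually (\<lambda>n.
    measure_pmf.prob (random_assembly m n (k n)) {a. largest_component a \<le> j}
      \<le> exp (- (\<mu> j n * e n * (1 - u)))) sequentially"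
proof -
  obtain e where e: "e \<longlonglongrightarrow> 1"
    "eventually (\<lambda>n. \<forall>T u v. j \<in> T \<longrightarrow> 0 \<notin> T \<longrightarrow> 0 \<le> u \<longrightarrow> u \<le> v \<longrightarrow> v \<le> 1 \<longrightarrow> 1/2 \<le> u \<or> 1 \<notin> T \<longrightarrow>
      tilted T u n \<le> tilted T v n * exp (- (\<mu> j n * e n * (v - u)))) sequentially"
    using tilted_growth_ge[of j] assms by auto
  have "eventually (\<lambda>n. measure_pmf.prob (random_assembly m n (k n)) {a. largest_component a \<le> j}
      \<le> exp (- (\<mu> j n * e n * (1 - u)))) sequentially"
    using e(2) admissible coef_pos
  proof eventually_elim
    case (elim n)
    have "measure_pmf.prob (random_assembly m n (k n)) {a. largest_component a \<le> j}
        \<le> (tilt (shifted_egf m) {j..} u ^ k n) $ (n - k n) / (1 * (shifted_egf m ^ k n) $ (n - k n))"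
      by (rule prob_random_assembly_le[OF m_pos])
        (use elim(2) assms largest_component_le_iff in auto)
    also have "\<dots> = tilted {j..} u n / coef n" using elim(2) by simp
    also have "tilted {j..} u n \<le> coef n * exp (- (\<mu> j n * e n * (1 - u)))"
      using elim(1)[rule_format, of "{j..}" u 1] assms by auto
    then have "tilted {j..} u n / coef n \<le> exp (- (\<mu> j n * e n * (1 - u)))"
      using elim(3) by (simp add: field_simps)
    finally show ?case .
  qed
  then show thesis using e(1) that by blast
qed

lemma prob_largest_tendsto_1:
  assumes "j \<ge> 2" "\<mu> j \<longlonglongrightarrow> 0"
  shows "(\<lambda>n. measure_pmf.prob (random_assembly m n (k n)) {a. largest_component a \<le> j}) \<longlonglongrightarrow> 1"
proof -
  obtain e where e: "e \<longlonglongrightarrow> 1" "eventually (\<lambda>n. exp (- (\<mu> j n * e n))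
    \<le> measure_pmf.prob (random_assembly m n (k n)) {a. largest_component a \<le> j}) sequentially"
    using prob_largest_ge[OF assms(1)] by blast
  have "(\<lambda>n. exp (- (\<mu> j n * e n))) \<longlonglongrightarrow> exp (- (0 * 1))"
    by (intro tendsto_intros assms e)
  then show ?thesis
    by (intro tendsto_sandwich[OF e(2) _ _ tendsto_const]) (auto simp: measure_pmf.prob_le_1)
qed

lemma prob_largest_tendsto_0:
  assumes "j \<ge> 1" "filterlim (\<mu> j) at_top sequentially" "filterlim r at_top sequentially"
  shows "(\<lambda>n. measure_pmf.prob (random_assembly m n (k n)) {a. largest_component a \<le> j}) \<longlonglongrightarrow> 0"
proof -
  obtain e where e: "e \<longlonglongrightarrow> 1" "eventually (\<lambda>n.
    measure_pmf.prob (random_assembly m n (k n)) {a. largest_component a \<le> j}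
      \<le> exp (- (\<mu> j n * e n * (1 - 1/2)))) sequentially"
    \<comment> \<open>Tilt \<open>1/2\<close> halves the exponent, which is harmless for
      \<open>\<mu> j\<close> tending to infinity, and it includes \<open>j = 1\<close>.\<close>
    using prob_largest_le[OF assms(1), of "1/2"] assms by auto
  have "(\<lambda>n. e n * (1 - 1/2)) \<longlonglongrightarrow> 1 * (1 - 1/2)" by (intro tendsto_intros e)
  then have "filterlim (\<lambda>n. e n * (1 - 1/2) * \<mu> j n) at_top sequentially"
    by (rule filterlim_tendsto_pos_mult_at_top) (use assms in auto)
  then have "(\<lambda>n. exp (- (\<mu> j n * e n * (1 - 1/2)))) \<longlonglongrightarrow> 0"
    by (intro filterlim_compose[OF exp_at_bot] filterlim_compose[OF filterlim_uminus_at_bot_at_top])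
      (simp add: mult_ac)
  then show ?thesis
    by (intro tendsto_sandwich[OF _ e(2) tendsto_const]) (auto simp: always_eventually)
qed

lemma prob_largest_tendsto_exp:
  assumes "j \<ge> 2" "\<mu> j \<longlonglongrightarrow> c" "filterlim r at_top sequentially"
  shows "(\<lambda>n. measure_pmf.prob (random_assembly m n (k n)) {a. largest_component a \<le> j}) \<longlonglongrightarrow> exp (- c)"
proof -
  obtain e where e: "e \<longlonglongrightarrow> 1" "eventually (\<lambda>n. exp (- (\<mu> j n * e n))
    \<le> measure_pmf.prob (random_assembly m n (k n)) {a. largest_component a \<le> j}) sequentially"
    using prob_largest_ge[OF assms(1)] by blast
  obtain e' where e': "e' \<longlonglongrightarrow> 1" "eventually (\<lambda>n.
    measure_pmf.prob (random_assembly m n (k n)) {a. largest_component a \<le> j}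
      \<le> exp (- (\<mu> j n * e' n * (1 - 0)))) sequentially"
    using prob_largest_le[of j 0] assms by auto
  have "(\<lambda>n. exp (- (\<mu> j n * e n))) \<longlonglongrightarrow> exp (- (c * 1))"
    "(\<lambda>n. exp (- (\<mu> j n * e' n * (1 - 0)))) \<longlonglongrightarrow> exp (- (c * 1 * (1 - 0)))"
    by (intro tendsto_intros assms e e')+
  then show ?thesis by (intro tendsto_sandwich[OF e(2) e'(2)]) auto
qed

lemma excess_count_upper_tail:
  assumes "s \<ge> 1" "0 < \<eta>" "\<eta> \<le> 1"
  shows "eventually (\<lambda>n. measure_pmf.prob (random_assembly m n (k n))
    {a. real (excess_count {s} a) \<ge> (1 + \<eta>) * \<mu> s n} \<le> exp (- (\<eta>\<^sup>2 / 16 * \<mu> s n))) sequentially"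
proof -
  obtain e where e: "e \<longlonglongrightarrow> 1"
    "eventually (\<lambda>n. \<forall>T u v. T \<subseteq> {s..} \<longrightarrow> u \<le> v \<longrightarrow> u \<ge> 1 \<or> u \<ge> 0 \<and> 1 \<notin> T \<longrightarrow>
      tilted T v n \<le> tilted T u n * exp (\<mu> s n * e n * (v - u))) sequentially"
    using tilted_growth_le[of s] assms by auto
  \<comment> \<open>Chernoff's method: the exponent per unit of \<open>\<mu>\<close> is
    \<open>e (v - 1) - (1 + \<eta>) ln v\<close>. With \<open>e < 1 + \<eta> / 4\<close> and
    \<open>ln (1 + y) \<ge> y - y^2\<close> it is at most
    \<open>\<eta>^3 / 16 - \<eta>^2 / 8\<close>.\<close>
  define v where "v = 1 + \<eta> / 4"
  have v: "v > 1" using assms by (simp add: v_def)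
  have "\<eta> / 4 - (\<eta> / 4)\<^sup>2 \<le> ln v"
    unfolding v_def using assms by (intro ln_one_plus_pos_lower_bound) auto
  then have "(1 + \<eta>) * (\<eta> / 4 - (\<eta> / 4)\<^sup>2) \<le> (1 + \<eta>) * ln v"
    using assms by (intro mult_left_mono) auto
  moreover have "(1 + \<eta> / 4) * (\<eta> / 4) - (1 + \<eta>) * (\<eta> / 4 - (\<eta> / 4)\<^sup>2) \<le> - (\<eta>\<^sup>2 / 16)"
  proof -
    have "\<eta> * \<eta>\<^sup>2 \<le> 1 * \<eta>\<^sup>2" using assms by (intro mult_right_mono) auto
    moreover have "(1 + \<eta> / 4) * (\<eta> / 4) - (1 + \<eta>) * (\<eta> / 4 - (\<eta> / 4)\<^sup>2)
        = \<eta> * \<eta>\<^sup>2 / 16 - \<eta>\<^sup>2 / 8"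
      by (simp add: power2_eq_square field_simps)
    ultimately show ?thesis by simp
  qed
  ultimately have ln_v: "(1 + \<eta> / 4) * (v - 1) - (1 + \<eta>) * ln v \<le> - (\<eta>\<^sup>2 / 16)" by (simp add: v_def)
  have "eventually (\<lambda>n. e n < 1 + \<eta> / 4) sequentially"
    using order_tendstoD(2)[OF e(1), of "1 + \<eta> / 4"] assms by simp
  then show ?thesis using e(2) admissible coef_pos
  proof eventually_elim
    case (elim n)
    have "measure_pmf.prob (random_assembly m n (k n)) {a. real (excess_count {s} a) \<ge> (1 + \<eta>) * \<mu> s n}
        \<le> (tilt (shifted_egf m) {s} v ^ k n) $ (n - k n)
          / (v powr ((1 + \<eta>) * \<mu> s n) * (shifted_egf m ^ k n) $ (n - k n))"
      by (rule prob_random_assembly_le[OF m_pos])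
        (use elim(3) v in \<open>auto simp flip: powr_realpow intro!: powr_mono\<close>)
    also have "\<dots> = tilted {s} v n / coef n / v powr ((1 + \<eta>) * \<mu> s n)" using elim(3) by simp
    also have "tilted {s} v n \<le> coef n * exp (\<mu> s n * e n * (v - 1))"
      using elim(2)[rule_format, of "{s}" 1 v] v by auto
    then have "tilted {s} v n / coef n / v powr ((1 + \<eta>) * \<mu> s n)
        \<le> exp (\<mu> s n * e n * (v - 1)) / v powr ((1 + \<eta>) * \<mu> s n)"
      using elim(4) by (intro divide_right_mono) (auto simp: field_simps)
    also have "\<dots> = exp (\<mu> s n * (e n * (v - 1) - (1 + \<eta>) * ln v))"
      using v by (simp add: powr_def algebra_simps flip: exp_diff)
    also have "\<dots> \<le> exp (\<mu> s n * - (\<eta>\<^sup>2 / 16))"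
    proof -
      have "e n * (v - 1) \<le> (1 + \<eta> / 4) * (v - 1)" using elim(1) v by (intro mult_right_mono) auto
      then have "e n * (v - 1) - (1 + \<eta>) * ln v \<le> - (\<eta>\<^sup>2 / 16)" using ln_v by linarith
      then show ?thesis using mu_nonneg by (simp only: exp_le_cancel_iff) (rule mult_left_mono)
    qed
    finally show ?case by (simp add: mult.commute)
  qed
qed

lemma excess_count_lower_tail:
  assumes "s \<ge> 1" "0 < \<eta>" "\<eta> \<le> 1" "filterlim r at_top sequentially"
  shows "eventually (\<lambda>n. measure_pmf.prob (random_assembly m n (k n))
    {a. real (excess_count {s} a) \<le> (1 - \<eta>) * \<mu> s n} \<le> exp (- (\<eta>\<^sup>2 / 16 * \<mu> s n))) sequentially"
proof -
  obtain e where e: "e \<longlonglongrightarrow> 1"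
    "eventually (\<lambda>n. \<forall>T u v. s \<in> T \<longrightarrow> 0 \<notin> T \<longrightarrow> 0 \<le> u \<longrightarrow> u \<le> v \<longrightarrow> v \<le> 1 \<longrightarrow> 1/2 \<le> u \<or> 1 \<notin> T \<longrightarrow>
      tilted T u n \<le> tilted T v n * exp (- (\<mu> s n * e n * (v - u)))) sequentially"
    using tilted_growth_ge[of s] assms by auto
  \<comment> \<open>Since \<open>\<eta> \<le> 1\<close>, this tilt stays above \<open>1/2\<close>,
    so that \<open>s = 1\<close> is covered too. The estimate
    \<open>ln (1 - y) \<ge> - y - 2 y^2\<close> bounds the exponent.\<close>
  define v where "v = 1 - \<eta> / 4"
  have v: "1/2 \<le> v" "v < 1" using assms by (simp_all add: v_def)
  have "- (\<eta> / 4) - 2 * (\<eta> / 4)\<^sup>2 \<le> ln v"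
    unfolding v_def using assms by (intro ln_one_minus_pos_lower_bound) auto
  then have "(1 - \<eta>) * (- (\<eta> / 4) - 2 * (\<eta> / 4)\<^sup>2) \<le> (1 - \<eta>) * ln v"
    using assms by (intro mult_left_mono) auto
  moreover have "- ((1 - \<eta> / 4) * (\<eta> / 4)) - (1 - \<eta>) * (- (\<eta> / 4) - 2 * (\<eta> / 4)\<^sup>2) \<le> - (\<eta>\<^sup>2 / 16)"
  proof -
    have "0 \<le> \<eta> * \<eta>\<^sup>2" using assms by simp
    moreover have "- ((1 - \<eta> / 4) * (\<eta> / 4)) - (1 - \<eta>) * (- (\<eta> / 4) - 2 * (\<eta> / 4)\<^sup>2)
        = - (\<eta>\<^sup>2 / 16) - \<eta> * \<eta>\<^sup>2 / 8"
      by (simp add: power2_eq_square field_simps)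
    ultimately show ?thesis by simp
  qed
  ultimately have ln_v: "- ((1 - \<eta> / 4) * (1 - v)) - (1 - \<eta>) * ln v \<le> - (\<eta>\<^sup>2 / 16)" by (simp add: v_def)
  have "eventually (\<lambda>n. e n > 1 - \<eta> / 4) sequentially"
    using order_tendstoD(1)[OF e(1), of "1 - \<eta> / 4"] assms by simp
  then show ?thesis using e(2) admissible coef_pos
  proof eventually_elim
    case (elim n)
    have "measure_pmf.prob (random_assembly m n (k n)) {a. real (excess_count {s} a) \<le> (1 - \<eta>) * \<mu> s n}
        \<le> (tilt (shifted_egf m) {s} v ^ k n) $ (n - k n)
          / (v powr ((1 - \<eta>) * \<mu> s n) * (shifted_egf m ^ k n) $ (n - k n))"
      by (rule prob_random_assembly_le[OF m_pos])
        (use elim(3) v in \<open>auto simp flip: powr_realpow intro!: powr_mono'\<close>)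
    also have "\<dots> = tilted {s} v n / coef n / v powr ((1 - \<eta>) * \<mu> s n)" using elim(3) by simp
    also have "tilted {s} v n \<le> coef n * exp (- (\<mu> s n * e n * (1 - v)))"
      using elim(2)[rule_format, of "{s}" v 1] v assms by auto
    then have "tilted {s} v n / coef n / v powr ((1 - \<eta>) * \<mu> s n)
        \<le> exp (- (\<mu> s n * e n * (1 - v))) / v powr ((1 - \<eta>) * \<mu> s n)"
      using elim(4) by (intro divide_right_mono) (auto simp: field_simps)
    also have "\<dots> = exp (\<mu> s n * (- (e n * (1 - v)) - (1 - \<eta>) * ln v))"
      using v by (simp add: powr_def algebra_simps flip: exp_diff)
    also have "\<dots> \<le> exp (\<mu> s n * - (\<eta>\<^sup>2 / 16))"
    proof -
      have "(1 - \<eta> / 4) * (1 - v) \<le> e n * (1 - v)" using elim(1) v by (intro mult_right_mono) auto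
      then have "- (e n * (1 - v)) - (1 - \<eta>) * ln v \<le> - (\<eta>\<^sup>2 / 16)" using ln_v by linarith
      then show ?thesis using mu_nonneg by (simp only: exp_le_cancel_iff) (rule mult_left_mono)
    qed
    finally show ?case by (simp add: mult.commute)
  qed
qed

text \<open>Shows where the threshold comes from: up to a constant \<open>\<mu> (Suc l) n\<close> is
  \<open>r^(l+1) / k^l\<close>, and \<open>n^l\<close> is the power \<open>l + 1\<close> of
  \<open>n powr (l / (l + 1))\<close>.\<close>

lemma mu_Suc_eq:
  "eventually (\<lambda>n. \<mu> (Suc l) n = shifted_egf m $ Suc l * (shifted_egf m $ 0) ^ l / (shifted_egf m $ 1) ^ Suc l
    * (real (r n) / real n powr (real l / (1 + real l))) ^ Suc l * (real n / real (k n)) ^ l) sequentially"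
  using k_pos eventually_ge_at_top[of 1]
proof eventually_elim
  case (elim n)
  have "(real n powr (real l / (1 + real l))) ^ Suc l = real n powr real l"
    using elim by (simp add: powr_realpow[symmetric] powr_powr add_eq_0_iff_both_eq_0 del: power_Suc)
  also have "\<dots> = real n ^ l" using elim by (simp add: powr_realpow)
  finally have *: "(real n powr (real l / (1 + real l))) ^ Suc l = real n ^ l" .
  show ?case
    unfolding \<mu>_def power_divide * using elim A_pos[of 0] A_pos[of 1] A_pos[of "Suc l"]
    by (simp add: power_mult_distrib field_simps)
qed

lemma mu_Suc_tendsto:
  assumes "(\<lambda>n. real (r n) / real n powr (real l / (1 + real l))) \<longlonglongrightarrow> t"
  shows "\<mu> (Suc l) \<longlonglongrightarrow> shifted_egf m $ Suc l * (shifted_egf m $ 0) ^ l / (shifted_egf m $ 1) ^ Suc l * t ^ Suc l"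
proof -
  have "(\<lambda>n. shifted_egf m $ Suc l * (shifted_egf m $ 0) ^ l / (shifted_egf m $ 1) ^ Suc l
    * (real (r n) / real n powr (real l / (1 + real l))) ^ Suc l * (real n / real (k n)) ^ l)
    \<longlonglongrightarrow> shifted_egf m $ Suc l * (shifted_egf m $ 0) ^ l / (shifted_egf m $ 1) ^ Suc l * t ^ Suc l * 1 ^ l"
    by (intro tendsto_mult tendsto_power tendsto_const assms n_over_k)
  then show ?thesis using mu_Suc_eq[of l] by (simp add: tendsto_cong del: power_Suc)
qed

lemma mu_Suc_at_top:
  assumes "filterlim (\<lambda>n. real (r n) / real n powr (real l / (1 + real l))) at_top sequentially"
  shows "filterlim (\<mu> (Suc l)) at_top sequentially"
proof -
  let ?C = "shifted_egf m $ Suc l * (shifted_egf m $ 0) ^ l / (shifted_egf m $ 1) ^ Suc l"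
  have C: "?C > 0" using A_pos by (intro divide_pos_pos mult_pos_pos zero_less_power)
  have "(\<lambda>n. ?C * (real n / real (k n)) ^ l) \<longlonglongrightarrow> ?C * 1 ^ l"
    by (intro tendsto_mult tendsto_power tendsto_const n_over_k)
  then have "filterlim (\<lambda>n. ?C * (real n / real (k n)) ^ l
      * (real (r n) / real n powr (real l / (1 + real l))) ^ Suc l) at_top sequentially"
    by (rule filterlim_tendsto_pos_mult_at_top) (use C in \<open>auto intro!: filterlim_pow_at_top assms simp del: power_Suc\<close>)
  moreover have "eventually (\<lambda>n. \<mu> (Suc l) n = ?C * (real n / real (k n)) ^ l
      * (real (r n) / real n powr (real l / (1 + real l))) ^ Suc l) sequentially"
    using mu_Suc_eq[of l] by eventually_elim (simp only: mult_ac)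
  ultimately show ?thesis by (simp add: filterlim_cong del: power_Suc)
qed

end

section \<open>Powers of n and summable tails\<close>

lemma filterlim_real_powr_at_top:
  fixes a :: real
  assumes "a > 0"
  shows "filterlim (\<lambda>n. real n powr a) at_top sequentially"
proof -
  have "(\<lambda>n. real n powr - a) \<longlonglongrightarrow> 0"
    using assms by (intro tendsto_neg_powr filterlim_real_sequentially) simp
  moreover have "eventually (\<lambda>n. real n powr - a > 0) sequentially"
    using eventually_ge_at_top[of 1] by eventually_elim simp
  ultimately have "filterlim (\<lambda>n. inverse (real n powr - a)) at_top sequentially"
    by (rule filterlim_inverse_at_top)
  then show ?thesis by (simp add: powr_minus)
qed

lemma summable_exp_neg_powr:
  fixes b \<delta> :: real
  assumes "b > 0" "\<delta> > 0"
  shows "summable (\<lambda>n. exp (- (b * real n powr \<delta>)))"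
proof -
  \<comment> \<open>Eventually \<open>y^N \<le> exp y\<close> for \<open>y = b n^\<delta>\<close>;
    with \<open>N \<delta> \<ge> 2\<close> this gives comparison with \<open>n^(-2)\<close>.\<close>
  obtain N :: nat where N: "2 \<le> real N * \<delta>"
    using reals_Archimedean3[OF assms(2)] by (meson less_imp_le)
  have "filterlim (\<lambda>n. real n powr \<delta>) at_top sequentially"
    by (rule filterlim_real_powr_at_top[OF assms(2)])
  then have "filterlim (\<lambda>n. b * real n powr \<delta>) at_top sequentially"
    by (rule filterlim_tendsto_pos_mult_at_top[OF tendsto_const assms(1)])
  then have "(\<lambda>n. (b * real n powr \<delta>) ^ N / exp (b * real n powr \<delta>)) \<longlonglongrightarrow> 0"
    by (rule filterlim_compose[OF tendsto_power_div_exp_0])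
  then have "eventually (\<lambda>n. (b * real n powr \<delta>) ^ N / exp (b * real n powr \<delta>) < 1) sequentially"
    by (rule order_tendstoD) simp
  then have "eventually (\<lambda>n. norm (exp (- (b * real n powr \<delta>))) \<le> 1 / b ^ N * real n powr - 2) sequentially"
    using eventually_ge_at_top[of 1]
  proof eventually_elim
    case (elim n)
    have "b ^ N * real n powr 2 \<le> b ^ N * (real n powr \<delta>) ^ N"
    proof (rule mult_left_mono)
      have "real n powr 2 \<le> real n powr (real N * \<delta>)" using elim N by (intro powr_mono) auto
      also have "\<dots> = (real n powr \<delta>) ^ N"
        using elim by (simp add: powr_realpow[symmetric] powr_powr mult.commute)
      finally show "real n powr 2 \<le> (real n powr \<delta>) ^ N" .
    qed (use assms in auto)
    also have "\<dots> \<le> exp (b * real n powr \<delta>)" using elim by (simp add: power_mult_distrib)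
    finally have *: "b ^ N * real n powr 2 \<le> exp (b * real n powr \<delta>)" .
    have "exp (- (b * real n powr \<delta>)) = 1 / exp (b * real n powr \<delta>)" by (simp add: exp_minus inverse_eq_divide)
    also have "\<dots> \<le> 1 / (b ^ N * real n powr 2)"
      using elim assms by (intro divide_left_mono * mult_pos_pos) auto
    also have "\<dots> = 1 / b ^ N * real n powr - 2" by (simp add: powr_minus_divide)
    finally show ?case by simp
  qed
  then show ?thesis
    by (rule summable_comparison_test_ev) (intro summable_mult, simp add: summable_real_powr_iff)
qed

section \<open>The regimes of r and almost sure asymptotics of the counts\<close>

context assembly_sequence
begin

lemma r_at_top:
  assumes "a \<ge> 0" "filterlim (\<lambda>n. real (r n) / real n powr a) at_top sequentially"
  shows "filterlim r at_top sequentially"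
proof -
  have "filterlim (\<lambda>n. real (r n)) at_top sequentially"
    using assms(2)
  proof (rule filterlim_at_top_mono)
    show "eventually (\<lambda>n. real (r n) / real n powr a \<le> real (r n)) sequentially"
      using eventually_ge_at_top[of 1]
    proof eventually_elim
      case (elim n)
      then have "1 \<le> real n powr a" using assms(1) by (simp add: ge_one_powr_ge_zero)
      then have "real (r n) / real n powr a \<le> real (r n) / 1" by (intro divide_left_mono) (use elim in auto)
      then show ?case by simp
    qed
  qed
  then show ?thesis by (simp add: filterlim_sequentially_iff_filterlim_real)
qed

lemma prob_largest_tendsto_0_of_large:
  assumes "filterlim (\<lambda>n. real (r n) / real n powr (real l / (1 + real l))) at_top sequentially"
  shows "(\<lambda>n. measure_pmf.prob (random_assembly m n (k n)) {a. largest_component a \<le> Suc l}) \<longlonglongrightarrow> 0"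
  by (rule prob_largest_tendsto_0[OF _ mu_Suc_at_top[OF assms] r_at_top[OF _ assms]]) auto

lemma prob_largest_tendsto_1_of_small:
  assumes "l \<ge> 1" "(\<lambda>n. real (r n) / real n powr (real l / (1 + real l))) \<longlonglongrightarrow> 0"
  shows "(\<lambda>n. measure_pmf.prob (random_assembly m n (k n)) {a. largest_component a \<le> Suc l}) \<longlonglongrightarrow> 1"
  using mu_Suc_tendsto[OF assms(2)] assms(1) by (intro prob_largest_tendsto_1) auto

lemma prob_largest_eq_Suc:
  "measure_pmf.prob (random_assembly m n (k n)) {a. largest_component a = Suc j}
    = measure_pmf.prob (random_assembly m n (k n)) {a. largest_component a \<le> Suc j}
      - measure_pmf.prob (random_assembly m n (k n)) {a. largest_component a \<le> j}"
  by (subst measure_pmf.finite_measure_Diff[symmetric]) (auto intro!: arg_cong[of _ _ "measure_pmf.prob _"])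

text \<open>At the critical scale for \<open>l\<close>, \<open>r\<close> is far above the threshold
  for \<open>l - 1\<close> and far below that for \<open>l + 1\<close>. So the largest component
  exceeds \<open>l\<close> and is at most \<open>l + 2\<close> with probability tending to 1, and
  the Poisson limit splits the mass between the two remaining sizes.\<close>

lemma prob_largest_critical:
  assumes l: "l \<ge> 1" and t: "t > 0"
    and lim: "(\<lambda>n. real (r n) / real n powr (real l / (1 + real l))) \<longlonglongrightarrow> t"
  shows "(\<lambda>n. measure_pmf.prob (random_assembly m n (k n)) {a. largest_component a = Suc l})
      \<longlonglongrightarrow> exp (- limit_lambda t l m)"
    and "(\<lambda>n. measure_pmf.prob (random_assembly m n (k n)) {a. largest_component a = Suc (Suc l)})
      \<longlonglongrightarrow> 1 - exp (- limit_lambda t l m)"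
proof -
  let ?P = "\<lambda>j n. measure_pmf.prob (random_assembly m n (k n)) {a. largest_component a \<le> j}"
  let ?e = "\<lambda>l. real l / (1 + real l)"
  have powr_lim: "(\<lambda>n. real (r n) / real n powr a) = (\<lambda>n. real (r n) / real n powr ?e l * real n powr (?e l - a))" for a
  proof
    fix n show "real (r n) / real n powr a = real (r n) / real n powr ?e l * real n powr (?e l - a)"
      \<comment> \<open>At \<open>n = 0\<close> both sides vanish because
        \<open>r 0 = 0\<close>.\<close>
      using r_def[of 0] by (cases "n = 0") (auto simp: powr_diff)
  qed
  obtain l' where l': "l = Suc l'" using l by (cases l) auto
  have "?e l' < ?e l" unfolding l' by (simp add: field_simps)
  then have "filterlim (\<lambda>n. real n powr (?e l - ?e l')) at_top sequentially"
    by (intro filterlim_real_powr_at_top) simp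
  then have "filterlim (\<lambda>n. real (r n) / real n powr ?e l') at_top sequentially"
    unfolding powr_lim[of "?e l'"] by (rule filterlim_tendsto_pos_mult_at_top[OF lim t])
  note small = prob_largest_tendsto_0_of_large[OF this, folded l'] and r = r_at_top[OF _ this]
  have "?e l < ?e (Suc l)" by (simp add: field_simps)
  then have "(\<lambda>n. real n powr (?e l - ?e (Suc l))) \<longlonglongrightarrow> 0"
    by (intro tendsto_neg_powr filterlim_real_sequentially) simp
  from tendsto_mult[OF lim this] have "(\<lambda>n. real (r n) / real n powr ?e (Suc l)) \<longlonglongrightarrow> 0"
    unfolding powr_lim[of "?e (Suc l)"] by (simp only: mult_zero_right)
  note large = prob_largest_tendsto_1_of_small[OF _ this]
  \<comment> \<open>The power of 2 in \<open>limit_lambda\<close> comes from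
    \<open>shifted_egf m $ 1 = m_2 / 2\<close>.\<close>
  have lam: "shifted_egf m $ Suc l * (shifted_egf m $ 0) ^ l / (shifted_egf m $ 1) ^ Suc l * t ^ Suc l
      = limit_lambda t l m"
  proof -
    have "shifted_egf m $ Suc l = real (m (l + 2)) / fact (l + 2)"
      "shifted_egf m $ 0 = real (m 1)" "shifted_egf m $ 1 = real (m 2) / 2"
      by (simp_all add: shifted_egf_def numeral_2_eq_2)
    then show ?thesis unfolding limit_lambda_def by (simp only: power_divide) simp
  qed
  have mid: "?P (Suc l) \<longlonglongrightarrow> exp (- limit_lambda t l m)"
    using mu_Suc_tendsto[OF lim] l r unfolding lam by (intro prob_largest_tendsto_exp) auto
  show "(\<lambda>n. measure_pmf.prob (random_assembly m n (k n)) {a. largest_component a = Suc l})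
      \<longlonglongrightarrow> exp (- limit_lambda t l m)"
    unfolding prob_largest_eq_Suc using tendsto_diff[OF mid small] by simp
  show "(\<lambda>n. measure_pmf.prob (random_assembly m n (k n)) {a. largest_component a = Suc (Suc l)})
      \<longlonglongrightarrow> 1 - exp (- limit_lambda t l m)"
    unfolding prob_largest_eq_Suc using l by (intro tendsto_diff mid large) auto
qed

text \<open>As \<open>r \<le> k\<close>, the power \<open>(r / k)^s\<close> decreases in
  \<open>s\<close>, so the worst case is \<open>s = l + 1\<close>, where
  \<open>k (r / k)^(l+1)\<close> is at least \<open>n^(c (l+1)) / n^l\<close>.\<close>

lemma mu_ge_powr:
  assumes "s \<le> Suc l" "eventually (\<lambda>n. real n powr c \<le> real (r n)) sequentially"
  obtains C where "C > 0"
    "eventually (\<lambda>n. C * real n powr (c * real (Suc l) - real l) \<le> \<mu> s n) sequentially"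
proof -
  define C where "C = shifted_egf m $ s / shifted_egf m $ 0 * (shifted_egf m $ 0 / shifted_egf m $ 1) ^ s"
  have C: "C > 0" unfolding C_def using A_pos by (intro mult_pos_pos divide_pos_pos zero_less_power)
  have "eventually (\<lambda>n. C * real n powr (c * real (Suc l) - real l) \<le> \<mu> s n) sequentially"
    using assms(2) r_le_k admissible k_pos
  proof eventually_elim
    case (elim n)
    have "real n powr (c * real (Suc l) - real l) = (real n powr c) ^ Suc l / real n ^ l"
      using elim by (simp add: powr_diff powr_realpow[symmetric] powr_powr del: power_Suc)
    also have "\<dots> \<le> real (r n) ^ Suc l / real (k n) ^ l"
      using elim by (intro frac_le power_mono) auto
    also have "\<dots> = real (k n) * (real (r n) / real (k n)) ^ Suc l"
      using elim by (simp add: power_divide)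
    also have "\<dots> \<le> real (k n) * (real (r n) / real (k n)) ^ s"
      using elim assms(1) by (intro mult_left_mono power_decreasing) auto
    finally have "C * real n powr (c * real (Suc l) - real l)
        \<le> C * (real (k n) * (real (r n) / real (k n)) ^ s)"
      using C by (intro mult_left_mono) auto
    also have "\<dots> = \<mu> s n" by (simp add: C_def \<mu>_def power_mult_distrib power_divide mult_ac)
    finally show ?case .
  qed
  then show thesis using C that by blast
qed

text \<open>Here \<open>\<mu> (i - 1)\<close> grows at least like \<open>n powr \<delta>\<close>
  with \<open>\<delta> > 0\<close>, so the Chernoff bounds are summable.\<close>

lemma AE_components_of_size_asymp:
  assumes coupled: "coupled_assemblies m k \<Omega> X"
    and i: "1 \<le> i" "i \<le> l + 2"
    and c: "eventually (\<lambda>n. real n powr c \<le> real (r n)) sequentially" "c > real l / (1 + real l)"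
  shows "AE \<omega> in \<Omega>. (\<lambda>n. real (components_of_size i (X n \<omega>))) \<sim>[sequentially] \<mu> (i - 1)"
proof (rule AE_asymp_equiv_of_summable[OF coupled])
  define \<delta> where "\<delta> = c * real (Suc l) - real l"
  have \<delta>: "\<delta> > 0" using c(2) by (simp add: \<delta>_def field_simps)
  have c_pos: "c > 0" using c(2) by (rule le_less_trans[rotated]) simp
  have "filterlim (\<lambda>n. real n powr c) at_top sequentially"
    by (rule filterlim_real_powr_at_top[OF c_pos])
  then have "filterlim (\<lambda>n. real (r n)) at_top sequentially"
    by (rule filterlim_at_top_mono) (fact c(1))
  then have r: "filterlim r at_top sequentially" by (simp add: filterlim_sequentially_iff_filterlim_real)
  have "i - 1 \<le> Suc l" using i by simp
  then obtain C where C: "C > 0"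
    "eventually (\<lambda>n. C * real n powr \<delta> \<le> \<mu> (i - 1) n) sequentially"
    unfolding \<delta>_def by (rule mu_ge_powr[OF _ c(1)])
  show "eventually (\<lambda>n. \<mu> (i - 1) n > 0) sequentially"
    using C(2) eventually_ge_at_top[of 1]
  proof eventually_elim
    case (elim n)
    have "0 < C * real n powr \<delta>" using C elim by simp
    then show ?case using elim by linarith
  qed
  fix \<eta> :: real assume \<eta>: "0 < \<eta>" "\<eta> \<le> 1"
  let ?E = "\<lambda>n. {a. \<bar>real (components_of_size i a) - \<mu> (i - 1) n\<bar> > \<eta> * \<mu> (i - 1) n}"
  show "\<exists>b. summable b \<and> (\<forall>\<^sub>F n in sequentially. measure_pmf.prob (random_assembly m n (k n)) (?E n) \<le> b n)"
  \<comment> \<open>Singletons are deterministic to first order: their number differs from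
    \<open>k\<close> by at most \<open>r\<close>, which is eventually below \<open>\<eta> k\<close>,
    so the exceptional event has probability 0.\<close>
  proof (cases "i = 1")
    case True
    have "eventually (\<lambda>n. real (r n) / real (k n) < \<eta>) sequentially"
      using order_tendstoD(2)[OF ratio] \<eta> by simp
    then have "eventually (\<lambda>n. measure_pmf.prob (random_assembly m n (k n)) (?E n) \<le> 0) sequentially"
      using admissible k_pos
    proof eventually_elim
      case (elim n)
      have mu: "\<mu> (i - 1) n = real (k n)" using True A_pos[of 0] by (simp add: \<mu>_def)
      have "?E n \<inter> assemblies_k m n (k n) = {}"
      proof (intro equalityI subsetI)
        fix a assume a: "a \<in> ?E n \<inter> assemblies_k m n (k n)"
        have "real (r n) < \<eta> * real (k n)" using elim by (simp add: pos_divide_less_eq)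
        moreover have "\<bar>real (components_of_size i a) - real (k n)\<bar> \<le> real (r n)"
          using components_of_size_one_bounds[of a m n "k n"] a elim True by auto
        moreover have "\<eta> * real (k n) < \<bar>real (components_of_size i a) - real (k n)\<bar>"
          using a unfolding mu by simp
        ultimately show "a \<in> {}" by linarith
      qed auto
      moreover have "set_pmf (random_assembly m n (k n)) = assemblies_k m n (k n)"
        by (rule set_random_assembly[OF m_pos]) (use elim in auto)
      ultimately show ?case
        by (subst measure_Int_set_pmf[symmetric]) simp
    qed
    then show ?thesis by (intro exI[of _ "\<lambda>_. 0"]) auto
  next
    case False
    then have s: "i - 1 \<ge> 1" using i by simp
    let ?b = "\<lambda>n. 2 * exp (- (\<eta>\<^sup>2 / 16 * C * real n powr \<delta>))"
    have "eventually (\<lambda>n. measure_pmf.prob (random_assembly m n (k n)) (?E n) \<le> ?b n) sequentially"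
      using excess_count_upper_tail[OF s \<eta>] excess_count_lower_tail[OF s \<eta> r] C(2) admissible
    proof eventually_elim
      case (elim n)
      let ?M = "random_assembly m n (k n)"
      let ?U = "{a. real (excess_count {i - 1} a) \<ge> (1 + \<eta>) * \<mu> (i - 1) n}"
      let ?L = "{a. real (excess_count {i - 1} a) \<le> (1 - \<eta>) * \<mu> (i - 1) n}"
      have "measure_pmf.prob ?M (?E n) = measure_pmf.prob ?M (?E n \<inter> assemblies_k m n (k n))"
        using set_random_assembly[OF m_pos, where n = n and k = "k n"] elim(4)
        by (subst measure_Int_set_pmf[symmetric]) simp
      also have "\<dots> \<le> measure_pmf.prob ?M (?U \<union> ?L)"
      proof (rule measure_pmf.finite_measure_mono)
        show "?E n \<inter> assemblies_k m n (k n) \<subseteq> ?U \<union> ?L"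
          using i components_of_size_eq by (auto simp: abs_if algebra_simps split: if_splits)
      qed simp
      also have "\<dots> \<le> measure_pmf.prob ?M ?U + measure_pmf.prob ?M ?L"
        by (rule measure_Un_le) simp_all
      also have "\<dots> \<le> 2 * exp (- (\<eta>\<^sup>2 / 16 * \<mu> (i - 1) n))" using elim by simp
      also have "\<dots> \<le> ?b n"
      proof -
        have "\<eta>\<^sup>2 / 16 * (C * real n powr \<delta>) \<le> \<eta>\<^sup>2 / 16 * \<mu> (i - 1) n"
          using elim by (intro mult_left_mono) auto
        then show ?thesis by (simp add: mult.assoc)
      qed
      finally show ?case .
    qed
    moreover have "summable ?b"
      using C(1) \<delta> \<eta> by (intro summable_mult summable_exp_neg_powr) auto
    ultimately show ?thesis by blast
  qed
qed

lemma pos_solution_asymp: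
  assumes r: "eventually (\<lambda>n. r n > 0) sequentially"
  shows "eventually (\<lambda>n. \<exists>x. smallest_pos_solution m (real (r n) / real (k n)) x) sequentially"
    and "eventually (\<lambda>n. smallest_pos_solution m (real (r n) / real (k n)) (x n)) sequentially \<Longrightarrow>
      i \<ge> 1 \<Longrightarrow> (\<lambda>n. real (k n) * (real (m i) * x n ^ (i - 1) / (real (m 1) * fact i)))
        \<sim>[sequentially] \<mu> (i - 1)"
proof -
  define \<rho> where "\<rho> = shifted_egf m $ 0 / shifted_egf m $ 1"
  have \<rho>: "\<rho> > 0" using A_pos by (simp add: \<rho>_def)
  let ?c = "\<lambda>n. real (r n) / real (k n)"
  obtain c0 C where c0: "c0 > 0"
    "\<And>c. 0 < c \<Longrightarrow> c < c0 \<Longrightarrow> \<exists>x. smallest_pos_solution m c x"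
    "\<And>c x. 0 < c \<Longrightarrow> c < c0 \<Longrightarrow> smallest_pos_solution m c x \<Longrightarrow> \<rho> * c \<le> x \<and> x \<le> \<rho> * c * (1 + C * c)"
    unfolding \<rho>_def using smallest_pos_solution_asymp[OF m_pos radius] by blast
  have c: "eventually (\<lambda>n. 0 < ?c n \<and> ?c n < c0) sequentially"
    using order_tendstoD(2)[OF ratio c0(1)] r k_pos by eventually_elim simp
  then show "eventually (\<lambda>n. \<exists>x. smallest_pos_solution m (?c n) x) sequentially"
    by eventually_elim (use c0(2) in blast)
  assume x: "eventually (\<lambda>n. smallest_pos_solution m (?c n) (x n)) sequentially" and i: "i \<ge> 1"
  \<comment> \<open>The saddle point is asymptotic to \<open>\<rho> r / k\<close>; replacing it by
    this value turns the formula into \<open>\<mu> (i - 1)\<close>.\<close>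
  have lim: "(\<lambda>n. x n / (\<rho> * ?c n)) \<longlonglongrightarrow> 1"
  proof (rule tendsto_sandwich)
    show "eventually (\<lambda>n. 1 \<le> x n / (\<rho> * ?c n)) sequentially"
      using c x
    proof eventually_elim
      case (elim n)
      then have "\<rho> * ?c n > 0" using \<rho> by (intro mult_pos_pos) auto
      then show ?case using c0(3)[of "?c n" "x n"] elim by (subst pos_le_divide_eq) auto
    qed
    show "eventually (\<lambda>n. x n / (\<rho> * ?c n) \<le> 1 + C * ?c n) sequentially"
      using c x
    proof eventually_elim
      case (elim n)
      then have "\<rho> * ?c n > 0" using \<rho> by (intro mult_pos_pos) auto
      then show ?case using c0(3)[of "?c n" "x n"] elim
        by (subst pos_divide_le_eq) (auto simp: mult.commute)
    qed
    have "(\<lambda>n. 1 + C * ?c n) \<longlonglongrightarrow> 1 + C * 0" by (intro tendsto_intros ratio)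
    then show "(\<lambda>n. 1 + C * ?c n) \<longlonglongrightarrow> 1" by simp
  qed auto
  show "(\<lambda>n. real (k n) * (real (m i) * x n ^ (i - 1) / (real (m 1) * fact i))) \<sim>[sequentially] \<mu> (i - 1)"
  proof (rule asymp_equivI')
    have "(\<lambda>n. (x n / (\<rho> * ?c n)) ^ (i - 1)) \<longlonglongrightarrow> 1 ^ (i - 1)" by (intro tendsto_power lim)
    then have "(\<lambda>n. (x n / (\<rho> * ?c n)) ^ (i - 1)) \<longlonglongrightarrow> 1" by simp
    moreover have "eventually (\<lambda>n. (x n / (\<rho> * ?c n)) ^ (i - 1)
      = real (k n) * (real (m i) * x n ^ (i - 1) / (real (m 1) * fact i)) / \<mu> (i - 1) n) sequentially"
      using c k_pos
    proof eventually_elim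
      case (elim n)
      define c' where "c' = \<rho> * ?c n"
      have "c' > 0" unfolding c'_def using elim \<rho> by (intro mult_pos_pos) auto
      have "shifted_egf m $ (i - 1) = real (m i) / fact i" "shifted_egf m $ 0 = real (m 1)"
        using i by (cases i; simp add: shifted_egf_def)+
      moreover have "shifted_egf m $ 0 * real (r n) / (shifted_egf m $ 1 * real (k n)) = c'"
        by (simp add: \<rho>_def c'_def)
      ultimately have "\<mu> (i - 1) n = real (k n) * (real (m i) / fact i) / real (m 1) * c' ^ (i - 1)"
        by (simp only: \<mu>_def)
      then show ?case
        unfolding c'_def[symmetric] using elim m_pos[OF i] m_pos[of 1] \<open>c' > 0\<close>
        by (simp add: power_divide)
    qed
    ultimately show "(\<lambda>n. real (k n) * (real (m i) * x n ^ (i - 1) / (real (m 1) * fact i)) / \<mu> (i - 1) n)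
      \<longlonglongrightarrow> 1" by (rule Lim_transform_eventually)
  qed
qed

end

section \<open>From the stated growth hypotheses to the limit theorem\<close>

lemma powr_le_of_Liminf_log:
  fixes r :: "nat \<Rightarrow> nat"
  assumes "Liminf sequentially (\<lambda>n. ereal (log (real n) (real (r n)))) > ereal a" "a \<ge> 0"
  obtains c where "c > a" "eventually (\<lambda>n. real n powr c \<le> real (r n)) sequentially"
proof -
  obtain c where c: "a < c" "ereal c < Liminf sequentially (\<lambda>n. ereal (log (real n) (real (r n))))"
    using ereal_dense2[OF assms(1)] by auto
  have "eventually (\<lambda>n. real n powr c \<le> real (r n)) sequentially"
    using less_LiminfD[OF c(2)] eventually_ge_at_top[of 2]
  proof eventually_elim
    case (elim n)
    \<comment> \<open>In HOL \<open>ln 0 = 0\<close>, so \<open>r n = 0\<close> would make the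
      logarithm 0, which is not above \<open>c > a \<ge> 0\<close>.\<close>
    have "r n \<noteq> 0"
    proof
      assume "r n = 0"
      then show False using elim c assms(2) by (simp add: log_def)
    qed
    then show ?case using elim by (simp add: less_log_iff)
  qed
  then show thesis using that c by blast
qed

theorem theorem3p14:
  fixes m k :: "nat \<Rightarrow> nat" and r :: "nat \<Rightarrow> nat" and l :: nat and \<epsilon> :: real
  assumes m_pos: "\<And>i. i \<ge> 1 \<Longrightarrow> m i > 0"
    and radius: "fps_conv_radius (assembly_egf m) > 0"
    and k_range: "\<And>n. n \<ge> 1 \<Longrightarrow> 1 \<le> k n \<and> k n \<le> n"
    and r_def: "\<And>n. r n = n - k n"
    and eps: "\<epsilon> > 0"
    and r_small: "(\<lambda>n. real (r n)) \<in> o(\<lambda>n. real n powr (1 - \<epsilon>))"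
    and l: "l \<ge> 1"
  shows
    "((\<lambda>n. real (r n)) \<in> o(\<lambda>n. real n powr (real l / (1 + real l))) \<longrightarrow>
        (\<lambda>n. measure_pmf.prob (random_assembly m n (k n)) {a. largest_component a \<le> l + 1})
          \<longlonglongrightarrow> 1)
   \<and> ((\<lambda>n. real n powr (real l / (1 + real l))) \<in> o(\<lambda>n. real (r n)) \<longrightarrow>
        (\<lambda>n. measure_pmf.prob (random_assembly m n (k n)) {a. largest_component a > l + 1})
          \<longlonglongrightarrow> 1)
   \<and> (Liminf sequentially (\<lambda>n. ereal (log (real n) (real (r n)))) > ereal (real l / (real l + 1)) \<longrightarrow>
        (\<forall>\<^sub>F n in sequentially. \<exists>x. smallest_pos_solution m (real (r n) / real (k n)) x) \<and>
        (\<forall>x. (\<forall>\<^sub>F n in sequentially. smallest_pos_solution m (real (r n) / real (k n)) (x n)) \<longrightarrow>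
          (\<forall>(\<Omega> :: 'w measure) A. coupled_assemblies m k \<Omega> A \<longrightarrow>
            (\<forall>i. 1 \<le> i \<and> i \<le> l + 2 \<longrightarrow>
              (AE \<omega> in \<Omega>. (\<lambda>n. real (components_of_size i (A n \<omega>))) \<sim>[sequentially]
                 (\<lambda>n. real (k n) * (real (m i) * x n ^ (i - 1) / (real (m 1) * fact i))))))))
   \<and> (\<forall>t>0. (\<lambda>n. real (r n)) \<sim>[sequentially] (\<lambda>n. t * real n powr (real l / (1 + real l))) \<longrightarrow>
        (\<lambda>n. measure_pmf.prob (random_assembly m n (k n)) {a. largest_component a = l + 1})
          \<longlonglongrightarrow> exp (- limit_lambda t l m) \<and>
        (\<lambda>n. measure_pmf.prob (random_assembly m n (k n)) {a. largest_component a = l + 2})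
          \<longlonglongrightarrow> 1 - exp (- limit_lambda t l m))"
proof -
  have "(\<lambda>n. real (r n) / real n) \<longlonglongrightarrow> 0"
  proof -
    have "(\<lambda>n. real n powr - \<epsilon>) \<longlonglongrightarrow> 0"
      using eps by (intro tendsto_neg_powr filterlim_real_sequentially) simp
    then have "(\<lambda>n. real (r n) / real n powr (1 - \<epsilon>) * real n powr - \<epsilon>) \<longlonglongrightarrow> 0"
      using tendsto_mult[OF smalloD_tendsto[OF r_small]] by fastforce
    moreover have "eventually (\<lambda>n. real (r n) / real n powr (1 - \<epsilon>) * real n powr - \<epsilon>
        = real (r n) / real n) sequentially"
      using eventually_ge_at_top[of 1] by eventually_elim (simp add: powr_diff powr_minus field_simps)
    ultimately show ?thesis by (rule Lim_transform_eventually)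
  qed
  then interpret assembly_sequence m k r
    by unfold_locales (use m_pos radius k_range r_def in auto)
  let ?e = "real l / (1 + real l)"
  show ?thesis
  proof (intro conjI impI allI)
    assume "(\<lambda>n. real (r n)) \<in> o(\<lambda>n. real n powr ?e)"
    from prob_largest_tendsto_1_of_small[OF l smalloD_tendsto[OF this]]
    show "(\<lambda>n. measure_pmf.prob (random_assembly m n (k n)) {a. largest_component a \<le> l + 1}) \<longlonglongrightarrow> 1"
      by simp
  next
    assume large: "(\<lambda>n. real n powr ?e) \<in> o(\<lambda>n. real (r n))"
    \<comment> \<open>A quotient tending to 0 has a reciprocal tending to infinity once it is
      positive; the little-o bound with constant 1 forces \<open>r n > 0\<close>.\<close>
    have "eventually (\<lambda>n. real n powr ?e / real (r n) > 0) sequentially"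
      using landau_o.smallD[OF large zero_less_one] eventually_ge_at_top[of 1]
    proof eventually_elim
      case (elim n)
      then have "0 < real n powr ?e" by simp
      moreover have "real n powr ?e \<le> real (r n)" using elim by simp
      ultimately show ?case by (intro divide_pos_pos) linarith+
    qed
    then have "filterlim (\<lambda>n. inverse (real n powr ?e / real (r n))) at_top sequentially"
      by (rule filterlim_inverse_at_top[OF smalloD_tendsto[OF large]])
    then have "filterlim (\<lambda>n. real (r n) / real n powr ?e) at_top sequentially" by simp
    from prob_largest_tendsto_0_of_large[OF this]
    have "(\<lambda>n. 1 - measure_pmf.prob (random_assembly m n (k n)) {a. largest_component a \<le> Suc l}) \<longlonglongrightarrow> 1 - 0"
      by (intro tendsto_diff tendsto_const)
    also have "(\<lambda>n. 1 - measure_pmf.prob (random_assembly m n (k n)) {a. largest_component a \<le> Suc l})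
      = (\<lambda>n. measure_pmf.prob (random_assembly m n (k n)) {a. largest_component a > l + 1})"
      by (subst measure_pmf.prob_compl[symmetric]) (auto intro!: ext arg_cong[of _ _ "measure_pmf.prob _"])
    finally show "(\<lambda>n. measure_pmf.prob (random_assembly m n (k n)) {a. largest_component a > l + 1}) \<longlonglongrightarrow> 1"
      by simp
  next
    assume liminf: "Liminf sequentially (\<lambda>n. ereal (log (real n) (real (r n)))) > ereal (real l / (real l + 1))"
    obtain c where c: "c > real l / (real l + 1)" "eventually (\<lambda>n. real n powr c \<le> real (r n)) sequentially"
      using powr_le_of_Liminf_log[OF liminf] by auto
    have r_pos: "eventually (\<lambda>n. r n > 0) sequentially"
      using c(2) eventually_ge_at_top[of 1]
    proof eventually_elim
      case (elim n)
      have "0 < real n powr c" using elim by simp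
      then have "0 < real (r n)" using elim(1) by (rule less_le_trans)
      then show ?case by simp
    qed
    show "\<forall>\<^sub>F n in sequentially. \<exists>x. smallest_pos_solution m (real (r n) / real (k n)) x"
      by (rule pos_solution_asymp(1)[OF r_pos])
    fix x and \<Omega> :: "'w measure" and A i
    assume x: "\<forall>\<^sub>F n in sequentially. smallest_pos_solution m (real (r n) / real (k n)) (x n)"
      and coupled: "coupled_assemblies m k \<Omega> A" and i: "1 \<le> i \<and> i \<le> l + 2"
    have "AE \<omega> in \<Omega>. (\<lambda>n. real (components_of_size i (A n \<omega>))) \<sim>[sequentially] \<mu> (i - 1)"
      using AE_components_of_size_asymp[OF coupled _ _ c(2), of i l] i c(1) by (simp add: add.commute)
    then show "AE \<omega> in \<Omega>. (\<lambda>n. real (components_of_size i (A n \<omega>))) \<sim>[sequentially]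
        (\<lambda>n. real (k n) * (real (m i) * x n ^ (i - 1) / (real (m 1) * fact i)))"
    proof eventually_elim
      case (elim \<omega>)
      then show ?case
        using pos_solution_asymp(2)[OF r_pos x] i by (blast intro: asymp_equiv_trans asymp_equiv_symI)
    qed
  next
    fix t :: real assume t: "t > 0"
      and "(\<lambda>n. real (r n)) \<sim>[sequentially] (\<lambda>n. t * real n powr ?e)"
    then have "(\<lambda>n. real (r n) / (t * real n powr ?e)) \<longlonglongrightarrow> 1"
      by (rule_tac asymp_equivD_strong) (auto intro: eventually_mono[OF eventually_ge_at_top[of 1]])
    then have "(\<lambda>n. t * (real (r n) / (t * real n powr ?e))) \<longlonglongrightarrow> t * 1"
      by (intro tendsto_mult tendsto_const)
    then have lim: "(\<lambda>n. real (r n) / real n powr ?e) \<longlonglongrightarrow> t" using t by simp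
    show "(\<lambda>n. measure_pmf.prob (random_assembly m n (k n)) {a. largest_component a = l + 1})
          \<longlonglongrightarrow> exp (- limit_lambda t l m)"
      using prob_largest_critical(1)[OF l t lim] by simp
    show "(\<lambda>n. measure_pmf.prob (random_assembly m n (k n)) {a. largest_component a = l + 2})
          \<longlonglongrightarrow> 1 - exp (- limit_lambda t l m)"
      using prob_largest_critical(2)[OF l t lim] by simp
  qed
qed

end
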